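(* Let $M$ be a free abelian group of rank $n$, $N=\mathrm{Hom}(M,\mathbf{Z})$, and let $\Delta\subset M_{\mathbf{Q}}$ be a polyhedron such that $(\Delta,M)$ is a reflexive pair. Then $(\Delta^*,N)$ is again a reflexive pair, where $\Delta^*\subset N_{\mathbf{Q}}$ is the dual set of $\Delta$.
   Context: $M_{\mathbf{Q}}=M\otimes\mathbf{Q}$, $N_{\mathbf{Q}}=N\otimes\mathbf{Q}$, and $\langle\cdot,\cdot\rangle: M_{\mathbf{Q}}\times N_{\mathbf{Q}}\to\mathbf{Q}$ is the natural pairing. For a compact convex set $P\subset M_{\mathbf{Q}}$ containing $0$ in its interior, the dual set is $P^*=\{y\in N_{\mathbf{Q}} : \langle x,y\rangle\ge -1 \text{ for all } x\in P\}$. A polyhedron is a convex polytope; it is integral if its vertices are lattice points. If $H=\{x\in M_{\mathbf{Q}} : \langle x,l\rangle=c\}$ is a rational affine hyperplane affinely generated by its lattice points, with $l\in N$ primitive and $c\in\mathbf{Z}$, the integral distance between $H$ and $p\in M$ is $|c-\langle p,l\rangle|$. A pair $(\Delta,M)$, where $\Delta\subset M_{\mathbf{Q}}$ is an $n$-dimensional convex polyhedron with vertices in $M$ containing $0$ in its interior, is called reflexive if the integral distance between $0$ and every affine hyperplane generated by an $(n-1)$-dimensional face of $\Delta$ equals $1$. The same definition is used with $N$ in place of $M$. *)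

theory Defs
  imports "HOL-Analysis.Analysis"
begin

section \<open>Abelian groups as modules over the integers\<close>

definition zscale :: "int \<Rightarrow> 'm::ab_group_add \<Rightarrow> 'm" where
  "zscale k x =
     (if 0 \<le> k then (((+) x) ^^ nat k) 0 else - (((+) x) ^^ nat (- k)) 0)"

lemma zscale_0 [simp]: "zscale 0 x = 0"
  by (simp add: zscale_def)

lemma zscale_plus1: "zscale (k + 1) x = zscale k x + x"
proof -
  consider "0 \<le> k" | "k = -1" | "k < -1" by linarith
  then show ?thesis
  proof cases
    case 1
    then have "nat (k + 1) = Suc (nat k)" by simp
    with 1 show ?thesis by (simp add: zscale_def add.commute)
  next
    case 2
    then show ?thesis by (simp add: zscale_def)
  next
    case 3
    then have "nat (- k) = Suc (nat (- (k + 1)))" by simp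
    with 3 show ?thesis by (simp add: zscale_def)
  qed
qed

lemma zscale_minus1: "zscale (k - 1) x = zscale k x - x"
  using zscale_plus1[of "k - 1" x] by simp

lemma zscale_1 [simp]: "zscale 1 x = x"
  using zscale_plus1[of 0 x] by simp

lemma zscale_add_left: "zscale (j + k) x = zscale j x + zscale k x"
proof (induction k rule: int_induct[where k = 0])
  case (step1 i)
  then show ?case
    by (simp add: zscale_plus1 flip: add.assoc)
next
  case (step2 i)
  have "zscale (j + (i - 1)) x = zscale ((j + i) - 1) x"
    by (simp add: algebra_simps)
  with step2 show ?case
    by (simp add: zscale_minus1)
qed simp

lemma zscale_add_right: "zscale k (x + y) = zscale k x + zscale k y"
  by (induction k rule: int_induct[where k = 0])
     (simp_all add: zscale_plus1 zscale_minus1)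

lemma zscale_minus_left: "zscale (- k) x = - zscale k x"
  using zscale_add_left[of k "- k" x] by (simp add: eq_neg_iff_add_eq_0 add.commute)

lemma zscale_mult: "zscale j (zscale k x) = zscale (j * k) x"
  by (induction j rule: int_induct[where k = 0])
     (simp_all add: zscale_plus1 zscale_minus1 distrib_right left_diff_distrib
        zscale_add_left zscale_minus_left diff_conv_add_uminus del: add_uminus_conv_diff)

global_interpretation zmod: module "zscale :: int \<Rightarrow> 'm::ab_group_add \<Rightarrow> 'm"
  by unfold_locales (simp_all add: zscale_add_left zscale_add_right zscale_mult)

lemma additive_zscale:
  fixes f :: "'a::ab_group_add \<Rightarrow> 'b::ab_group_add"
  assumes "Modules.additive f"
  shows "f (zscale k x) = zscale k (f x)"
  by (induction k rule: int_induct[where k = 0])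
     (simp_all add: zscale_plus1 zscale_minus1 Modules.additive.add[OF assms]
        Modules.additive.diff[OF assms] Modules.additive.zero[OF assms])

lemma zscale_int [simp]: "zscale k (j :: int) = k * j"
  by (induction k rule: int_induct[where k = 0])
     (simp_all add: zscale_plus1 zscale_minus1 algebra_simps)

lemma zscale_rat [simp]: "zscale k (r :: rat) = of_int k * r"
  by (induction k rule: int_induct[where k = 0])
     (simp_all add: zscale_plus1 zscale_minus1 algebra_simps)

definition free_abelian_of_rank :: "'m::ab_group_add itself \<Rightarrow> nat \<Rightarrow> bool" where
  "free_abelian_of_rank _ n \<longleftrightarrow>
     (\<exists>B :: 'm set. finite B \<and> card B = n \<and> zmod.independent B \<and> zmod.span B = UNIV)"


section \<open>The dual group\<close>

typedef (overloaded) 'm zdual = "{f :: 'm::ab_group_add \<Rightarrow> int. Modules.additive f}"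
  morphisms zdual_apply Abs_zdual
  by (rule exI[of _ "\<lambda>_. 0"]) (simp add: Modules.additive_def)

setup_lifting type_definition_zdual

instantiation zdual :: (ab_group_add) ab_group_add
begin

lift_definition zero_zdual :: "'a zdual" is "\<lambda>_. 0"
  by (simp add: Modules.additive_def)

lift_definition plus_zdual :: "'a zdual \<Rightarrow> 'a zdual \<Rightarrow> 'a zdual" is "\<lambda>f g x. f x + g x"
  by (simp add: Modules.additive_def)

lift_definition uminus_zdual :: "'a zdual \<Rightarrow> 'a zdual" is "\<lambda>f x. - f x"
  by (simp add: Modules.additive_def)

lift_definition minus_zdual :: "'a zdual \<Rightarrow> 'a zdual \<Rightarrow> 'a zdual" is "\<lambda>f g x. f x - g x"
  by (simp add: Modules.additive_def)

instance
  by standard (transfer; simp add: fun_eq_iff)+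

end

lemma additive_zdual_apply: "Modules.additive (zdual_apply f)"
  using zdual_apply[of f] by simp

lemma zdual_apply_zscale: "zdual_apply f (zscale k x) = k * zdual_apply f x"
  by (simp add: additive_zscale[OF additive_zdual_apply])


section \<open>Extension of scalars to the rationals\<close>

text \<open>
  The tensor product of an abelian group with the rationals, realised as the localisation at the
  nonzero integers. The universal property is the lemma \<open>rtensor_universal\<close> below.
\<close>

definition rtensor_rel :: "'m::ab_group_add \<times> int \<Rightarrow> 'm \<times> int \<Rightarrow> bool" where
  "rtensor_rel x y \<longleftrightarrow> snd x \<noteq> 0 \<and> snd y \<noteq> 0 \<and>
     (\<exists>k. k \<noteq> 0 \<and> zscale (k * snd y) (fst x) = zscale (k * snd x) (fst y))"

lemma ex_nonzero_int [simp]: "\<exists>k :: int. k \<noteq> 0"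
  by (rule exI[of _ 1]) simp

lemma rtensor_rel_iff:
  "rtensor_rel (m, a) (m', b) \<longleftrightarrow>
     a \<noteq> 0 \<and> b \<noteq> 0 \<and> (\<exists>k. k \<noteq> 0 \<and> zscale (k * b) m = zscale (k * a) m')"
  by (simp add: rtensor_rel_def)

lemma part_equivp_rtensor_rel: "part_equivp (rtensor_rel :: 'm::ab_group_add \<times> int \<Rightarrow> _)"
proof (rule part_equivpI)
  show "\<exists>x :: 'm \<times> int. rtensor_rel x x"
    by (rule exI[of _ "(0, 1)"]) (auto simp: rtensor_rel_iff)
  show "symp (rtensor_rel :: 'm \<times> int \<Rightarrow> _)"
    unfolding symp_def rtensor_rel_def by metis
  show "transp (rtensor_rel :: 'm \<times> int \<Rightarrow> _)"
  proof (rule transpI, clarsimp simp: rtensor_rel_iff)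
    fix x y z :: 'm and a b c k l :: int
    assume nz: "b \<noteq> 0" "k \<noteq> 0" "l \<noteq> 0"
      and 1: "zscale (k * b) x = zscale (k * a) y"
      and 2: "zscale (l * c) y = zscale (l * b) z"
    have "zscale ((k * l * b) * c) x = zscale (l * c) (zscale (k * b) x)"
      by (simp add: zscale_mult ac_simps)
    also have "\<dots> = zscale (k * a) (zscale (l * c) y)"
      unfolding 1 by (simp add: zscale_mult ac_simps)
    also have "\<dots> = zscale ((k * l * b) * a) z"
      unfolding 2 by (simp add: zscale_mult ac_simps)
    finally show "\<exists>k. k \<noteq> 0 \<and> zscale (k * c) x = zscale (k * a) z"
      using nz by (intro exI[of _ "k * l * b"]) simp
  qed
qed

quotient_type (overloaded) 'm rtensor = "'m::ab_group_add \<times> int" / partial: rtensor_rel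
  by (rule part_equivp_rtensor_rel)

lift_definition of_lattice :: "'m::ab_group_add \<Rightarrow> 'm rtensor" is "\<lambda>m. (m, 1)"
  by (auto simp: rtensor_rel_iff)

lift_definition rfrac :: "'m::ab_group_add \<Rightarrow> int \<Rightarrow> 'm rtensor"
  is "\<lambda>m a. if a = 0 then (0, 1) else (m, a)"
  by (auto simp: rtensor_rel_iff intro: exI[of _ 1])

instantiation rtensor :: (ab_group_add) ab_group_add
begin

lift_definition zero_rtensor :: "'a rtensor" is "(0, 1)"
  by (auto simp: rtensor_rel_iff)

lift_definition plus_rtensor :: "'a rtensor \<Rightarrow> 'a rtensor \<Rightarrow> 'a rtensor"
  is "\<lambda>(m, a) (m', b). (zscale b m + zscale a m', a * b)"
proof (clarsimp simp: rtensor_rel_iff)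
  fix x x' y y' :: 'a and a a' b b' k l :: int
  assume nz: "k \<noteq> 0" "l \<noteq> 0"
    and 1: "zscale (k * a') x = zscale (k * a) x'"
    and 2: "zscale (l * b') y = zscale (l * b) y'"
  have "zscale (k * l * (a' * b')) (zscale b x + zscale a y) =
      zscale (l * b * b') (zscale (k * a') x) + zscale (k * a * a') (zscale (l * b') y)"
    by (simp add: zscale_add_right zscale_mult ac_simps)
  also have "\<dots> = zscale (k * l * (a * b)) (zscale b' x' + zscale a' y')"
    unfolding 1 2 by (simp add: zscale_add_right zscale_mult ac_simps)
  finally show "\<exists>k. k \<noteq> 0 \<and> zscale (k * (a' * b')) (zscale b x + zscale a y) =
      zscale (k * (a * b)) (zscale b' x' + zscale a' y')"
    using nz by (intro exI[of _ "k * l"]) simp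
qed

lift_definition uminus_rtensor :: "'a rtensor \<Rightarrow> 'a rtensor" is "\<lambda>(m, a). (- m, a)"
  by (auto simp: rtensor_rel_iff)

definition minus_rtensor :: "'a rtensor \<Rightarrow> 'a rtensor \<Rightarrow> 'a rtensor"
  where "minus_rtensor x y = x + - y"

instance
proof
  fix x y z :: "'a rtensor"
  show "x + y + z = x + (y + z)"
    by transfer (auto simp: rtensor_rel_iff zscale_add_right zscale_mult ac_simps
        intro!: exI[of _ 1])
  show "x + y = y + x"
    by transfer (auto simp: rtensor_rel_iff ac_simps intro!: exI[of _ 1])
  show "0 + x = x"
    by transfer (auto simp: rtensor_rel_iff intro!: exI[of _ 1])
  show "- x + x = 0"
    by transfer (auto simp: rtensor_rel_iff intro!: exI[of _ 1])
  show "x - y = x + - y"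
    by (rule minus_rtensor_def)
qed

end

lift_definition qscale :: "rat \<Rightarrow> 'm::ab_group_add rtensor \<Rightarrow> 'm rtensor"
  is "\<lambda>r (m, a). (zscale (fst (quotient_of r)) m, snd (quotient_of r) * a)"
proof -
  fix r :: rat and u v :: "'m \<times> int"
  assume rel: "rtensor_rel u v"
  obtain x a y b where uv: "u = (x, a)" "v = (y, b)" by (cases u, cases v)
  with rel obtain k where nz: "a \<noteq> 0" "b \<noteq> 0" "k \<noteq> 0"
    and 1: "zscale (k * b) x = zscale (k * a) y"
    by (auto simp: rtensor_rel_iff)
  define p q where "p = fst (quotient_of r)" and "q = snd (quotient_of r)"
  have q: "q \<noteq> 0" using quotient_of_denom_pos'[of r] by (simp add: q_def)
  have "zscale (k * (q * b)) (zscale p x) = zscale (p * q) (zscale (k * b) x)"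
    by (simp add: zscale_mult ac_simps)
  also have "\<dots> = zscale (k * (q * a)) (zscale p y)"
    unfolding 1 by (simp add: zscale_mult ac_simps)
  finally have "rtensor_rel (zscale p x, q * a) (zscale p y, q * b)"
    using nz q by (auto simp: rtensor_rel_iff)
  then show "rtensor_rel
      (case u of (m, a) \<Rightarrow> (zscale (fst (quotient_of r)) m, snd (quotient_of r) * a))
      (case v of (m, a) \<Rightarrow> (zscale (fst (quotient_of r)) m, snd (quotient_of r) * a))"
    by (simp add: uv p_def q_def)
qed

lemma rtensor_cases [cases type: rtensor]:
  fixes x :: "'m::ab_group_add rtensor"
  obtains m a where "x = rfrac m a" "a \<noteq> 0"
proof -
  have "\<exists>m a. x = rfrac m a \<and> a \<noteq> 0"
  proof transfer
    fix x :: "'m \<times> int"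
    assume "rtensor_rel x x"
    then show "\<exists>m a. rtensor_rel x (if a = 0 then (0, 1) else (m, a)) \<and> a \<noteq> 0"
      by (cases x) (auto simp: rtensor_rel_iff intro!: exI[of _ "fst x"] exI[of _ "snd x"])
  qed
  then show ?thesis using that by blast
qed

lemma rfrac_eq_iff:
  assumes "a \<noteq> 0" "b \<noteq> 0"
  shows "rfrac m a = rfrac m' b \<longleftrightarrow> (\<exists>k. k \<noteq> 0 \<and> zscale (k * b) m = zscale (k * a) m')"
  using assms by transfer (auto simp: rtensor_rel_iff)

lemma of_lattice_conv_rfrac: "of_lattice m = rfrac m 1"
  by transfer (auto simp: rtensor_rel_iff)

lemma zero_conv_rfrac: "0 = rfrac 0 1"
  by transfer (auto simp: rtensor_rel_iff)

lemma rfrac_add: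
  assumes "a \<noteq> 0" "b \<noteq> 0"
  shows "rfrac m a + rfrac m' b = rfrac (zscale b m + zscale a m') (a * b)"
  using assms by transfer (auto simp: rtensor_rel_iff intro: exI[of _ 1])

lemma rfrac_minus: "- rfrac m a = rfrac (- m) a"
  by transfer (auto simp: rtensor_rel_iff intro: exI[of _ 1])

lemma qscale_Fract:
  assumes "q \<noteq> 0" "a \<noteq> 0"
  shows "qscale (Fract p q) (rfrac m a) = rfrac (zscale p m) (q * a)"
proof -
  obtain p' q' where pq: "quotient_of (Fract p q) = (p', q')" by force
  then have q': "q' \<noteq> 0" using quotient_of_denom_pos[OF pq] by simp
  have "Fract p q = Fract p' q'"
    using quotient_of_div[OF pq] by (simp add: Fract_of_int_quotient)
  then have eq: "p * q' = p' * q"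
    using assms q' by (simp add: eq_rat)
  have "qscale (Fract p q) (rfrac m a) = rfrac (zscale p' m) (q' * a)"
    using assms q' pq
    by transfer (auto simp: rtensor_rel_iff zscale_mult intro: exI[of _ 1])
  also have "\<dots> = rfrac (zscale p m) (q * a)"
  proof -
    have "zscale (1 * (q * a)) (zscale p' m) = zscale (a * (p' * q)) m"
      by (simp add: zscale_mult ac_simps)
    also have "\<dots> = zscale (1 * (q' * a)) (zscale p m)"
      unfolding eq[symmetric] by (simp add: zscale_mult ac_simps)
    finally show ?thesis
      using assms q' by (subst rfrac_eq_iff) (auto intro: exI[of _ 1])
  qed
  finally show ?thesis .
qed

global_interpretation qvs: vector_space "qscale :: rat \<Rightarrow> 'm::ab_group_add rtensor \<Rightarrow> 'm rtensor"
proof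
  fix r s :: rat and x y :: "'m rtensor"
  obtain p q where r: "r = Fract p q" "q \<noteq> 0" by (cases r) auto
  obtain p' q' where s: "s = Fract p' q'" "q' \<noteq> 0" by (cases s) auto
  obtain m a where x: "x = rfrac m a" "a \<noteq> 0" by (cases x)
  obtain m' b where y: "y = rfrac m' b" "b \<noteq> 0" by (cases y)
  show "qscale r (x + y) = qscale r x + qscale r y"
    using r x y
    by (auto simp: rfrac_add qscale_Fract rfrac_eq_iff zscale_add_right zscale_mult ac_simps
        intro!: exI[of _ 1])
  show "qscale (r + s) x = qscale r x + qscale s x"
    using r s x
    by (auto simp: rfrac_add qscale_Fract rfrac_eq_iff zscale_add_left zscale_add_right zscale_mult
        algebra_simps intro!: exI[of _ 1])
  show "qscale r (qscale s x) = qscale (r * s) x"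
    using r s x by (simp add: qscale_Fract zscale_mult ac_simps)
  show "qscale 1 x = x"
    using x by (simp add: One_rat_def qscale_Fract)
qed

lemma rfrac_conv_qscale:
  assumes "a \<noteq> 0"
  shows "rfrac m a = qscale (1 / of_int a) (of_lattice m)"
proof -
  have "1 / of_int a = Fract 1 a" by (simp add: Fract_of_int_quotient)
  then show ?thesis using assms by (simp add: of_lattice_conv_rfrac qscale_Fract)
qed

lemma of_lattice_additive: "Modules.additive of_lattice"
  by (simp add: Modules.additive_def of_lattice_conv_rfrac rfrac_add)

text \<open>
  The pure tensor of \<open>m\<close> and \<open>r\<close> is \<open>qscale r (of_lattice m)\<close>, and every biadditive map factors
  uniquely through it.
\<close>

lemma rtensor_universal:
  fixes \<beta> :: "'m::ab_group_add \<Rightarrow> rat \<Rightarrow> 'w::ab_group_add"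
  assumes add1: "\<And>r. Modules.additive (\<lambda>m. \<beta> m r)" and add2: "\<And>m. Modules.additive (\<beta> m)"
  shows "\<exists>!g. Modules.additive g \<and> (\<forall>m r. g (qscale r (of_lattice m)) = \<beta> m r)"
proof -
  have bal: "\<beta> (zscale k m) r = \<beta> m (of_int k * r)" for k m r
    using additive_zscale[OF add1, of k m r] additive_zscale[OF add2, of m k r] by simp
  define h where "h = (\<lambda>x. let p = (SOME p. snd p \<noteq> 0 \<and> x = rfrac (fst p) (snd p))
                        in \<beta> (fst p) (1 / of_int (snd p)))"
  have h: "h (rfrac m a) = \<beta> m (1 / of_int a)" if a: "a \<noteq> 0" for m a
  proof -
    define p where "p = (SOME p. snd p \<noteq> 0 \<and> rfrac m a = rfrac (fst p) (snd p))"
    have "snd p \<noteq> 0 \<and> rfrac m a = rfrac (fst p) (snd p)"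
      unfolding p_def by (rule someI[of _ "(m, a)"]) (use a in simp)
    then have b: "snd p \<noteq> 0" and eq: "rfrac m a = rfrac (fst p) (snd p)" by auto
    then obtain k where k: "k \<noteq> 0" "zscale (k * snd p) m = zscale (k * a) (fst p)"
      using a b by (auto simp: rfrac_eq_iff)
    let ?d = "1 / of_int (k * a * snd p) :: rat"
    have d: "1 / of_int a = of_int (k * snd p) * ?d" "1 / of_int (snd p) = of_int (k * a) * ?d"
      using a b k(1) by simp_all
    have "\<beta> m (1 / of_int a) = \<beta> (zscale (k * snd p) m) ?d"
      unfolding d(1) by (rule bal[symmetric])
    also have "\<dots> = \<beta> (fst p) (1 / of_int (snd p))"
      unfolding k(2) d(2) by (rule bal)
    finally show ?thesis
      by (simp add: h_def p_def Let_def)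
  qed
  have h_add: "Modules.additive h"
  proof
    fix x y :: "'m rtensor"
    obtain m a where x: "x = rfrac m a" "a \<noteq> 0" by (cases x)
    obtain m' b where y: "y = rfrac m' b" "b \<noteq> 0" by (cases y)
    have "h (x + y) = \<beta> (zscale b m + zscale a m') (1 / of_int (a * b))"
      using x y by (simp add: rfrac_add h)
    also have "\<dots> = h x + h y"
      using x y by (simp add: h Modules.additive.add[OF add1] bal)
    finally show "h (x + y) = h x + h y" .
  qed
  have h_eq: "h (qscale r (of_lattice m)) = \<beta> m r" for m r
  proof -
    obtain p q where r: "r = Fract p q" "q \<noteq> 0" by (cases r) auto
    have "h (qscale r (of_lattice m)) = \<beta> (zscale p m) (1 / of_int q)"
      using r by (simp add: of_lattice_conv_rfrac qscale_Fract h)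
    also have "\<dots> = \<beta> m r"
      using r(1) by (simp add: bal Fract_of_int_quotient)
    finally show ?thesis .
  qed
  have h_unique: "g = h" if "Modules.additive g" "\<forall>m r. g (qscale r (of_lattice m)) = \<beta> m r" for g
  proof
    fix x :: "'m rtensor"
    obtain m a where "x = rfrac m a" "a \<noteq> 0" by (cases x)
    then show "g x = h x"
      by (simp add: rfrac_conv_qscale that(2) h_eq)
  qed
  show ?thesis
  proof (rule ex1I[of _ h])
    show "Modules.additive h \<and> (\<forall>m r. h (qscale r (of_lattice m)) = \<beta> m r)"
      by (simp add: h_add h_eq)
  qed (rule h_unique; elim conjE; assumption)
qed

lift_definition pairing :: "'m::ab_group_add rtensor \<Rightarrow> 'm zdual rtensor \<Rightarrow> rat"
  is "\<lambda>(m, a) (f, b). of_int (zdual_apply f m) / of_int (a * b)"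
proof (clarsimp simp: rtensor_rel_iff)
  fix m m' :: 'm and f f' :: "'m zdual" and a a' b b' k l :: int
  assume nz: "a \<noteq> 0" "a' \<noteq> 0" "b \<noteq> 0" "b' \<noteq> 0" "k \<noteq> 0" "l \<noteq> 0"
    and 1: "zscale (k * a') m = zscale (k * a) m'"
    and 2: "zscale (l * b') f = zscale (l * b) f'"
  have ev: "Modules.additive (\<lambda>f. zdual_apply f m')"
    by (simp add: Modules.additive_def plus_zdual.rep_eq)
  have "k * a' * zdual_apply f m = k * a * zdual_apply f m'"
    using arg_cong[OF 1, of "zdual_apply f"] by (simp add: zdual_apply_zscale)
  then have 3: "a' * zdual_apply f m = a * zdual_apply f m'" using nz by simp
  have "l * b' * zdual_apply f m' = l * b * zdual_apply f' m'"
    using arg_cong[OF 2, of "\<lambda>f. zdual_apply f m'"] by (simp add: additive_zscale[OF ev])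
  then have 4: "b' * zdual_apply f m' = b * zdual_apply f' m'" using nz by simp
  have "zdual_apply f m * (a' * b') = b' * (a' * zdual_apply f m)"
    by (simp add: ac_simps)
  also have "\<dots> = a * (b' * zdual_apply f m')"
    unfolding 3 by (simp add: ac_simps)
  also have "\<dots> = zdual_apply f' m' * (a * b)"
    unfolding 4 by (simp add: ac_simps)
  finally have "zdual_apply f m * (a' * b') = zdual_apply f' m' * (a * b)" .
  then have "(of_int (zdual_apply f m) :: rat) * (of_int a' * of_int b') =
      of_int (zdual_apply f' m') * (of_int a * of_int b)"
    by (simp flip: of_int_mult)
  then show "(of_int (zdual_apply f m) / (of_int a * of_int b) :: rat) =
      of_int (zdual_apply f' m') / (of_int a' * of_int b')"
    using nz by (simp add: frac_eq_eq)
qed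

lemma pairing_rfrac:
  assumes "a \<noteq> 0" "b \<noteq> 0"
  shows "pairing (rfrac m a) (rfrac f b) = of_int (zdual_apply f m) / of_int (a * b)"
  using assms by (simp add: rfrac_def pairing.abs_eq rtensor_rel_iff)

lemma pairing_of_lattice: "pairing (of_lattice m) (of_lattice f) = of_int (zdual_apply f m)"
  by (simp add: of_lattice_conv_rfrac pairing_rfrac)


section \<open>Convex geometry over the rationals\<close>

text \<open>
  These are the notions of \<open>HOL-Analysis\<close> with rational in place of real scalars, since the
  library versions require the class \<open>real_vector\<close>.
\<close>

definition qconvex :: "'m::ab_group_add rtensor set \<Rightarrow> bool" where
  "qconvex S \<longleftrightarrow>
     (\<forall>x\<in>S. \<forall>y\<in>S. \<forall>u\<ge>0. \<forall>v\<ge>0. u + v = 1 \<longrightarrow> qscale u x + qscale v y \<in> S)"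

definition qaffine :: "'m::ab_group_add rtensor set \<Rightarrow> bool" where
  "qaffine S \<longleftrightarrow> (\<forall>x\<in>S. \<forall>y\<in>S. \<forall>u v. u + v = 1 \<longrightarrow> qscale u x + qscale v y \<in> S)"

definition qaff_dim :: "'m::ab_group_add rtensor set \<Rightarrow> int" where
  "qaff_dim S = (if S = {} then -1 else int (qvs.dim {x - y | x y. x \<in> S \<and> y \<in> S}))"

definition qopen_segment :: "'m::ab_group_add rtensor \<Rightarrow> 'm rtensor \<Rightarrow> 'm rtensor set" where
  "qopen_segment a b =
     {qscale (1 - u) a + qscale u b | u. 0 < u \<and> u < 1 \<and> a \<noteq> b}"

definition qface_of :: "'m::ab_group_add rtensor set \<Rightarrow> 'm rtensor set \<Rightarrow> bool"
  (infixr \<open>qface'_of\<close> 50) where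
  "F qface_of S \<longleftrightarrow> F \<subseteq> S \<and> qconvex F \<and>
     (\<forall>a\<in>S. \<forall>b\<in>S. \<forall>x\<in>F. x \<in> qopen_segment a b \<longrightarrow> a \<in> F \<and> b \<in> F)"

definition qvertex_of :: "'m::ab_group_add rtensor \<Rightarrow> 'm rtensor set \<Rightarrow> bool"
  (infixr \<open>qvertex'_of\<close> 50) where
  "v qvertex_of S \<longleftrightarrow> {v} qface_of S"

definition qpolytope :: "'m::ab_group_add rtensor set \<Rightarrow> bool" where
  "qpolytope P \<longleftrightarrow> (\<exists>V. finite V \<and> P = qconvex hull V)"

text \<open>
  The coarsest topology in which all linear functionals given by the pairing are continuous. For a
  free abelian group of finite rank n it is the usual topology of the n-dimensional rational space.
\<close>

definition qtopology :: "'m::ab_group_add rtensor topology" where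
  "qtopology = topology_generated_by {{x. a < pairing x y \<and> pairing x y < b} | a b y. True}"

lemma topspace_qtopology: "topspace (qtopology :: 'm::ab_group_add rtensor topology) = UNIV"
proof -
  have "\<exists>a b. a < pairing x y \<and> pairing x y < b" for x :: "'m rtensor" and y
    by (intro exI[of _ "pairing x y - 1"] exI[of _ "pairing x y + 1"]) simp
  then show ?thesis
    by (auto simp: qtopology_def topology_generated_by_topspace) blast
qed


section \<open>Reflexive pairs\<close>

definition dual_set :: "'m::ab_group_add rtensor set \<Rightarrow> 'm zdual rtensor set" where
  "dual_set P = {y. \<forall>x\<in>P. pairing x y \<ge> - 1}"

definition primitive :: "'m::ab_group_add \<Rightarrow> bool" where
  "primitive l \<longleftrightarrow> l \<noteq> 0 \<and> (\<forall>k l'. l = zscale k l' \<longrightarrow> \<bar>k\<bar> = 1)"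

text \<open>
  The integral distance is only defined for those hyperplanes that are affinely generated by their
  lattice points, so it is rendered as a relation.
\<close>

definition has_integral_distance ::
  "'m::ab_group_add rtensor set \<Rightarrow> 'm \<Rightarrow> int \<Rightarrow> bool" where
  "has_integral_distance H p d \<longleftrightarrow>
     H = qaffine hull (H \<inter> range of_lattice) \<and>
     (\<exists>(l :: 'm zdual) (c :: int). primitive l \<and>
        H = {x. pairing x (of_lattice l) = of_int c} \<and> d = \<bar>c - zdual_apply l p\<bar>)"

text \<open>
  The lattice is the type argument. Faces of dimension \<open>n - 1\<close> are required to be nonempty, as in
  the library's \<open>facet_of\<close>; this matters only for \<open>n = 0\<close>.
\<close>

definition reflexive_pair :: "nat \<Rightarrow> 'm::ab_group_add rtensor set \<Rightarrow> bool" where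
  "reflexive_pair n \<Delta> \<longleftrightarrow>
     qpolytope \<Delta> \<and> qaff_dim \<Delta> = int n \<and>
     (\<forall>v. v qvertex_of \<Delta> \<longrightarrow> v \<in> range of_lattice) \<and>
     0 \<in> qtopology interior_of \<Delta> \<and>
     (\<forall>F. F qface_of \<Delta> \<and> F \<noteq> {} \<and> qaff_dim F = int n - 1 \<longrightarrow>
        has_integral_distance (qaffine hull F) 0 1)"

end

theory Submission
  imports Defs
begin

text \<open>
  Write the polytope as the convex hull of a finite set \<open>V\<close>. Its dual is cut out by the finitely many
  inequalities \<open>\<langle>v, y\<rangle> \<ge> -1\<close> with \<open>v\<close> in \<open>V\<close>. Everything hinges on the constraints that are tight
  at a point \<open>y\<close> of the dual. If some direction \<open>z \<noteq> 0\<close> is orthogonal to all tight \<open>v\<close>, then \<open>y\<close> can be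
  moved along \<open>z\<close> and along \<open>-z\<close>, in both cases until a further constraint becomes tight; the moves
  stop because the origin is interior to the polytope, so that every \<open>z \<noteq> 0\<close> is negative on some
  \<open>v\<close>. Hence the dual is the convex hull of the points at which no such \<open>z\<close> exists, called basic
  below, and every vertex of the dual is basic. Basic points are determined by their tight sets, so
  there are finitely many of them (\<open>dual_set_eq_hull_basic\<close>, \<open>finite_basic\<close>, \<open>vertex_imp_basic\<close>).

  The vertices of the dual are lattice points: at a basic point \<open>y\<close> the tight \<open>v\<close> span the whole
  space, so the points of the polytope with \<open>\<langle>x, y\<rangle> = -1\<close> form a facet. By reflexivity its affine
  hull is also \<open>\<langle>x, l\<rangle> = c\<close> for a lattice point \<open>l\<close> and \<open>c = \<plusminus>1\<close>, and comparing the two equations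
  gives \<open>y = -c l\<close> (\<open>basic_imp_lattice\<close>).

  The facets of the dual are at distance 1: all points of a facet \<open>F\<close> share a tight \<open>v\<close>
  (\<open>face_common_tight\<close>), and for reasons of dimension \<open>F\<close> affinely generates the hyperplane
  \<open>\<langle>v, y\<rangle> = -1\<close> (\<open>qaffine_hull_of_codim_1\<close>). A generator that cuts out a facet is a vertex
  (\<open>tight_on_facet_is_vertex\<close>), hence a lattice point \<open>m\<close>. The facet contains a basic point, and this
  is a lattice point \<open>w\<close> with \<open>\<langle>m, w\<rangle> = -1\<close>; the mere existence of \<open>w\<close> shows that \<open>m\<close>, as a functional on
  the dual lattice, is primitive and that the hyperplane is affinely generated by its lattice
  points (\<open>lattice_hyperplane_integral_distance\<close>).

  The linear algebra behind this is the perfect duality of the two rational spaces, which comes from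
  the dual basis of a basis of the lattice.
\<close>

section \<open>The pairing between dual rational spaces\<close>

lemma pairing_add_left: "pairing (x + x') y = pairing x y + pairing x' y"
proof -
  obtain m a where x: "x = rfrac m a" "a \<noteq> 0" by (cases x)
  obtain m' a' where x': "x' = rfrac m' a'" "a' \<noteq> 0" by (cases x')
  obtain f b where y: "y = rfrac f b" "b \<noteq> 0" by (cases y)
  show ?thesis
    using x x' y
    by (simp add: rfrac_add pairing_rfrac Modules.additive.add[OF additive_zdual_apply]
        zdual_apply_zscale field_simps)
qed

lemma pairing_scale_left: "pairing (qscale r x) y = r * pairing x y"
proof -
  obtain p q where r: "r = Fract p q" "q \<noteq> 0" by (cases r) auto
  obtain m a where x: "x = rfrac m a" "a \<noteq> 0" by (cases x)
  obtain f b where y: "y = rfrac f b" "b \<noteq> 0" by (cases y)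
  show ?thesis
    using r(2) x y unfolding r(1)
    by (simp add: qscale_Fract pairing_rfrac zdual_apply_zscale) (simp add: Fract_of_int_quotient)
qed

lemma zdual_apply_plus: "zdual_apply (f + g) m = zdual_apply f m + zdual_apply g m"
  by (simp add: plus_zdual.rep_eq)

lemma zdual_apply_zscale_left: "zdual_apply (zscale k f) m = k * zdual_apply f m"
proof -
  have "Modules.additive (\<lambda>f. zdual_apply f m)"
    by (simp add: Modules.additive_def zdual_apply_plus)
  from additive_zscale[OF this] show ?thesis by simp
qed

lemma pairing_add_right: "pairing x (y + y') = pairing x y + pairing x y'"
proof -
  obtain m a where x: "x = rfrac m a" "a \<noteq> 0" by (cases x)
  obtain f b where y: "y = rfrac f b" "b \<noteq> 0" by (cases y)
  obtain f' b' where y': "y' = rfrac f' b'" "b' \<noteq> 0" by (cases y')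
  show ?thesis
    using x y y'
    by (simp add: rfrac_add pairing_rfrac zdual_apply_plus zdual_apply_zscale_left field_simps)
qed

lemma pairing_scale_right: "pairing x (qscale r y) = r * pairing x y"
proof -
  obtain p q where r: "r = Fract p q" "q \<noteq> 0" by (cases r) auto
  obtain m a where x: "x = rfrac m a" "a \<noteq> 0" by (cases x)
  obtain f b where y: "y = rfrac f b" "b \<noteq> 0" by (cases y)
  show ?thesis
    using r(2) x y unfolding r(1)
    by (simp add: qscale_Fract pairing_rfrac zdual_apply_zscale_left)
      (simp add: Fract_of_int_quotient)
qed

lemma vector_space_rat: "vector_space ((*) :: rat \<Rightarrow> rat \<Rightarrow> rat)"
  by unfold_locales (simp_all add: algebra_simps)

lemma linear_pairing_left: "Vector_Spaces.linear qscale (*) (\<lambda>x. pairing x y)"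
  by (simp add: Vector_Spaces.linear_iff qvs.vector_space_axioms vector_space_rat
      pairing_add_left pairing_scale_left)

lemma linear_pairing_right: "Vector_Spaces.linear qscale (*) (\<lambda>y. pairing x y)"
  by (simp add: Vector_Spaces.linear_iff qvs.vector_space_axioms vector_space_rat
      pairing_add_right pairing_scale_right)

lemmas pairing_left_hom = linear_pairing_left[THEN Vector_Spaces.linear.axioms(3)]
lemmas pairing_right_hom = linear_pairing_right[THEN Vector_Spaces.linear.axioms(3)]

lemmas pairing_linear =
  pairing_add_left pairing_scale_left pairing_add_right pairing_scale_right
  module_hom.zero[OF pairing_left_hom] module_hom.zero[OF pairing_right_hom]
  module_hom.neg[OF pairing_left_hom] module_hom.neg[OF pairing_right_hom]
  module_hom.diff[OF pairing_left_hom] module_hom.diff[OF pairing_right_hom]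

lemmas pairing_sum_left = module_hom.sum[OF pairing_left_hom]
lemmas pairing_sum_right = module_hom.sum[OF pairing_right_hom]

lemma subspace_annihilator_right: "qvs.subspace {y. \<forall>x\<in>X. pairing x y = 0}"
  by (auto simp: qvs.subspace_def pairing_linear)

lemma subspace_annihilator_left: "qvs.subspace {x. \<forall>y\<in>Y. pairing x y = 0}"
  by (auto simp: qvs.subspace_def pairing_linear)

lemma pairing_eq_0_imp_right_0:
  assumes "\<And>x. pairing x y = 0"
  shows "y = 0"
proof -
  obtain f b where y: "y = rfrac f b" "b \<noteq> 0" by (cases y)
  have "zdual_apply f m = 0" for m
    using assms[of "rfrac m 1"] y by (simp add: pairing_rfrac)
  then have "f = 0" by (simp add: zdual_apply_inject[symmetric] zero_zdual.rep_eq fun_eq_iff)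
  then show ?thesis using y by (simp add: zero_conv_rfrac rfrac_eq_iff)
qed

lemma biorthogonal_left:
  fixes e :: "'i \<Rightarrow> 'm::ab_group_add rtensor"
  assumes fin: "finite I"
    and bi: "\<And>i j. i \<in> I \<Longrightarrow> j \<in> I \<Longrightarrow> pairing (e i) (d j) = (if i = j then 1 else 0)"
  shows "inj_on e I" and "qvs.independent (e ` I)"
proof -
  show inj: "inj_on e I"
    by (rule inj_onI) (metis bi zero_neq_one)
  show "qvs.independent (e ` I)"
  proof (rule qvs.independent_if_scalars_zero)
    fix f x assume 0: "(\<Sum>x\<in>e ` I. qscale (f x) x) = 0" and "x \<in> e ` I"
    then obtain j where j: "j \<in> I" "x = e j" by auto
    have "pairing (\<Sum>i\<in>I. qscale (f (e i)) (e i)) (d j) = (\<Sum>i\<in>I. if i = j then f (e i) else 0)"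
      unfolding pairing_sum_left
      by (rule sum.cong) (auto simp: pairing_linear bi j)
    with 0 j show "f x = 0"
      by (simp add: sum.reindex[OF inj] fin pairing_linear)
  qed (use fin in simp)
qed

lemma biorthogonal_right:
  fixes d :: "'i \<Rightarrow> 'm::ab_group_add zdual rtensor"
  assumes fin: "finite I"
    and bi: "\<And>i j. i \<in> I \<Longrightarrow> j \<in> I \<Longrightarrow> pairing (e i) (d j) = (if i = j then 1 else 0)"
  shows "inj_on d I" and "qvs.independent (d ` I)"
proof -
  show inj: "inj_on d I"
    by (rule inj_onI) (metis bi zero_neq_one)
  show "qvs.independent (d ` I)"
  proof (rule qvs.independent_if_scalars_zero)
    fix f x assume 0: "(\<Sum>x\<in>d ` I. qscale (f x) x) = 0" and "x \<in> d ` I"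
    then obtain j where j: "j \<in> I" "x = d j" by auto
    have "pairing (e j) (\<Sum>i\<in>I. qscale (f (d i)) (d i)) = (\<Sum>i\<in>I. if i = j then f (d i) else 0)"
      unfolding pairing_sum_right
      by (rule sum.cong) (auto simp: pairing_linear bi j)
    with 0 j show "f x = 0"
      by (simp add: sum.reindex[OF inj] fin pairing_linear)
  qed (use fin in simp)
qed

lemma of_lattice_0: "of_lattice 0 = 0"
  by (simp add: of_lattice_conv_rfrac zero_conv_rfrac)

lemma span_of_lattice:
  assumes "zmod.span B = UNIV"
  shows "qvs.span (of_lattice ` B) = UNIV"
proof -
  have lat: "of_lattice m \<in> qvs.span (of_lattice ` B)" for m
  proof -
    have "m \<in> zmod.span B" using assms by simp
    then show ?thesis
    proof (induction rule: zmod.span_induct_alt)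
      case base
      show ?case
        by (simp add: of_lattice_0 qvs.span_zero)
    next
      case (step c x y)
      have "of_lattice (zscale c x) = qscale (of_int c) (of_lattice x)"
        using qscale_Fract[of 1 1 c x] by (simp add: of_lattice_conv_rfrac Fract_of_int_eq)
      then show ?case
        using step by (simp add: Modules.additive.add[OF of_lattice_additive] qvs.span_add
            qvs.span_scale qvs.span_base)
    qed
  qed
  have "x \<in> qvs.span (of_lattice ` B)" for x
    by (cases x) (simp add: rfrac_conv_qscale qvs.span_scale lat)
  then show ?thesis by auto
qed

lemma free_abelian_dual_basis:
  assumes "free_abelian_of_rank TYPE('m::ab_group_add) n"
  obtains B :: "'m::ab_group_add set" and \<beta> where "finite B" "card B = n" "zmod.span B = UNIV"
    "\<And>b c. b \<in> B \<Longrightarrow> c \<in> B \<Longrightarrow> zdual_apply (\<beta> c) b = (if b = c then 1 else 0)"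
proof -
  obtain B :: "'m set" where B: "finite B" "card B = n" "zmod.independent B" "zmod.span B = UNIV"
    using assms unfolding free_abelian_of_rank_def by blast
  define \<beta> where "\<beta> c = Abs_zdual (\<lambda>m. zmod.representation B m c)" for c
  have "zdual_apply (\<beta> c) = (\<lambda>m. zmod.representation B m c)" for c
    unfolding \<beta>_def using B
    by (intro Abs_zdual_inverse) (simp add: Modules.additive_def zmod.representation_add)
  with that[of B \<beta>] B show ?thesis by (auto simp: zmod.representation_basis)
qed

text \<open>
  A basis of the lattice and its dual basis become biorthogonal bases of the two rational spaces.
  Reading off the values of a linear functional on the first basis as coordinates in the second one
  shows that every functional is given by the pairing; applied to the functionals \<open>\<langle>\<cdot>, y\<rangle>\<close> this also
  yields that the second family spans.
\<close>

lemma biorthogonal_bases: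
  assumes "free_abelian_of_rank TYPE('m::ab_group_add) n"
  obtains B :: "'m::ab_group_add set" and e d where "finite B" "card B = n"
    "\<And>b c. b \<in> B \<Longrightarrow> c \<in> B \<Longrightarrow> pairing (e b) (d c) = (if b = c then 1 else 0)"
    "qvs.span (e ` B) = (UNIV :: 'm::ab_group_add rtensor set)" "qvs.span (d ` B) = UNIV"
    "\<And>f :: 'm::ab_group_add rtensor \<Rightarrow> rat.
      Vector_Spaces.linear qscale (*) f \<Longrightarrow> \<exists>y. \<forall>x. f x = pairing x y"
proof -
  obtain B :: "'m set" and \<beta> where B: "finite B" "card B = n" "zmod.span B = UNIV"
    "\<And>b c. b \<in> B \<Longrightarrow> c \<in> B \<Longrightarrow> zdual_apply (\<beta> c) b = (if b = c then 1 else 0)"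
    using free_abelian_dual_basis[OF assms] by blast
  define e :: "'m \<Rightarrow> 'm rtensor" where "e = of_lattice"
  define d where "d c = of_lattice (\<beta> c)" for c
  have bi: "pairing (e b) (d c) = (if b = c then 1 else 0)" if "b \<in> B" "c \<in> B" for b c
    using that B by (simp add: e_def d_def pairing_of_lattice)
  have e: "qvs.span (e ` B) = UNIV" unfolding e_def by (rule span_of_lattice) fact
  have rep: "f x = pairing x (\<Sum>b\<in>B. qscale (f (e b)) (d b))"
    if f: "Vector_Spaces.linear qscale (*) f" for f x
  proof -
    interpret vector_space_pair "qscale :: rat \<Rightarrow> 'm rtensor \<Rightarrow> _" "(*) :: rat \<Rightarrow> rat \<Rightarrow> rat"
      by (intro vector_space_pair.intro qvs.vector_space_axioms vector_space_rat)
    have "f x = (\<lambda>x. pairing x (\<Sum>b\<in>B. qscale (f (e b)) (d b))) x"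
    proof (rule linear_eq_on[OF f linear_pairing_left, of x "e ` B"])
      fix x assume "x \<in> e ` B"
      then obtain c where c: "c \<in> B" "x = e c" by auto
      then have "pairing x (\<Sum>b\<in>B. qscale (f (e b)) (d b)) = (\<Sum>b\<in>B. if b = c then f (e b) else 0)"
        unfolding pairing_sum_right
        by (intro sum.cong) (auto simp: pairing_linear bi)
      then show "f x = pairing x (\<Sum>b\<in>B. qscale (f (e b)) (d b))" using c B(1) by simp
    qed (simp add: e)
    then show ?thesis .
  qed
  have "y \<in> qvs.span (d ` B)" for y
  proof -
    have "y - (\<Sum>b\<in>B. qscale (pairing (e b) y) (d b)) = 0"
      by (rule pairing_eq_0_imp_right_0, subst module_hom.diff[OF pairing_right_hom],
          subst right_minus_eq, rule rep[OF linear_pairing_left])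
    then have "y = (\<Sum>b\<in>B. qscale (pairing (e b) y) (d b))" by simp
    also have "\<dots> \<in> qvs.span (d ` B)"
      by (intro qvs.span_sum qvs.span_scale qvs.span_base) auto
    finally show ?thesis .
  qed
  then have d: "qvs.span (d ` B) = UNIV" by auto
  have "\<exists>y. \<forall>x. f x = pairing x y" if "Vector_Spaces.linear qscale (*) f"
    for f :: "'m rtensor \<Rightarrow> rat"
    using rep[OF that] by blast
  with that[OF B(1,2) bi e d] show ?thesis by blast
qed

text \<open>
  Unlike nondegeneracy in the other argument, this fails for a general abelian group: the rational
  numbers have no nonzero homomorphisms to the integers.
\<close>

lemma pairing_eq_0_imp_left_0:
  assumes "free_abelian_of_rank TYPE('m::ab_group_add) n"
    and "\<And>y. pairing (x :: 'm::ab_group_add rtensor) y = 0"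
  shows "x = 0"
proof -
  obtain B :: "'m set" and e d where B: "finite B"
    "\<And>b c. b \<in> B \<Longrightarrow> c \<in> B \<Longrightarrow> pairing (e b :: 'm rtensor) (d c) = (if b = c then 1 else 0)"
    "qvs.span (e ` B) = UNIV"
    using biorthogonal_bases[OF assms(1)] by metis
  have "x \<in> qvs.span (e ` B)" using B by simp
  then obtain u where u: "x = (\<Sum>v\<in>e ` B. qscale (u v) v)"
    using B(1) by (auto simp: qvs.span_finite)
  have inj: "inj_on e B" using biorthogonal_left(1)[OF B(1,2)] .
  have x: "x = (\<Sum>b\<in>B. qscale (u (e b)) (e b))"
    using u by (simp add: sum.reindex[OF inj])
  have "u (e c) = 0" if c: "c \<in> B" for c
  proof -
    have "pairing x (d c) = (\<Sum>b\<in>B. if b = c then u (e b) else 0)"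
      unfolding x pairing_sum_left
      by (rule sum.cong) (auto simp: pairing_linear B c)
    then show ?thesis using assms(2) B(1) c by simp
  qed
  then show ?thesis unfolding x by simp
qed

lemma finite_basis_of_rtensor:
  assumes "free_abelian_of_rank TYPE('m::ab_group_add) n"
  obtains E :: "'m::ab_group_add rtensor set" where
    "finite_dimensional_vector_space qscale E" "card E = n"
proof -
  obtain B :: "'m set" and e d where B: "finite B" "card B = n"
    "\<And>b c. b \<in> B \<Longrightarrow> c \<in> B \<Longrightarrow> pairing (e b :: 'm rtensor) (d c) = (if b = c then 1 else 0)"
    "qvs.span (e ` B) = UNIV"
    using biorthogonal_bases[OF assms(1)] by metis
  note bi = biorthogonal_left[OF B(1,3)]
  have "finite_dimensional_vector_space qscale (e ` B)"
    by unfold_locales (use B bi in auto)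
  with that[of "e ` B"] B bi show ?thesis by (simp add: card_image)
qed

lemma finite_basis_of_dual_rtensor:
  assumes "free_abelian_of_rank TYPE('m::ab_group_add) n"
  obtains D :: "'m::ab_group_add zdual rtensor set" where
    "finite_dimensional_vector_space qscale D" "card D = n"
proof -
  obtain B :: "'m set" and e d where B: "finite B" "card B = n"
    "\<And>b c. b \<in> B \<Longrightarrow> c \<in> B \<Longrightarrow> pairing (e b :: 'm rtensor) (d c) = (if b = c then 1 else 0)"
    "qvs.span (d ` B) = UNIV"
    using biorthogonal_bases[OF assms(1)] by metis
  note bi = biorthogonal_right[OF B(1,3)]
  have "finite_dimensional_vector_space qscale (d ` B)"
    by unfold_locales (use B bi in auto)
  with that[of "d ` B"] B bi show ?thesis by (simp add: card_image)
qed

text \<open>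
  A proper subspace is killed by some nonzero linear functional, and functionals are given by the
  pairing.
\<close>

lemma span_eq_UNIV_if_annihilator_0:
  assumes free: "free_abelian_of_rank TYPE('m::ab_group_add) n"
    and ann: "\<And>y. (\<And>x. x \<in> S \<Longrightarrow> pairing (x :: 'm::ab_group_add rtensor) y = 0) \<Longrightarrow> y = 0"
  shows "qvs.span S = UNIV"
proof (rule ccontr)
  assume "qvs.span S \<noteq> UNIV"
  then obtain x0 where x0: "x0 \<notin> qvs.span S" by auto
  obtain C where C: "C \<subseteq> S" "qvs.independent C" "S \<subseteq> qvs.span C"
    using qvs.maximal_independent_subset by blast
  have x0C: "x0 \<notin> qvs.span C" using x0 C(1) qvs.span_mono by blast
  interpret vector_space_pair "qscale :: rat \<Rightarrow> 'm rtensor \<Rightarrow> _" "(*) :: rat \<Rightarrow> rat \<Rightarrow> rat"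
    by (intro vector_space_pair.intro qvs.vector_space_axioms vector_space_rat)
  obtain f where f: "Vector_Spaces.linear qscale (*) f"
    "\<forall>x\<in>insert x0 C. f x = (if x = x0 then 1 else 0)"
    using linear_independent_extend[OF qvs.independent_insertI[OF x0C C(2)],
        of "\<lambda>x. if x = x0 then 1 else 0"] by blast
  obtain y where y: "\<And>x. f x = pairing x y"
    using biorthogonal_bases[OF free] f(1) by metis
  have "pairing x y = 0" if "x \<in> C" for x
    using that f(2) y x0C qvs.span_base by (metis insertCI)
  then have "qvs.span C \<subseteq> {x. \<forall>y\<in>{y}. pairing x y = 0}"
    by (intro qvs.span_minimal subspace_annihilator_left) auto
  with C(3) have "y = 0" by (intro ann) auto
  then show False using f(2) y[of x0] by (simp add: pairing_linear)
qed

section \<open>Convex and affine hulls\<close>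

lemma qconvexD:
  "qconvex S \<Longrightarrow> x \<in> S \<Longrightarrow> y \<in> S \<Longrightarrow> 0 \<le> u \<Longrightarrow> 0 \<le> v \<Longrightarrow> u + v = 1 \<Longrightarrow>
    qscale u x + qscale v y \<in> S"
  by (simp add: qconvex_def)

lemma qaffineD:
  "qaffine S \<Longrightarrow> x \<in> S \<Longrightarrow> y \<in> S \<Longrightarrow> u + v = 1 \<Longrightarrow> qscale u x + qscale v y \<in> S"
  by (simp add: qaffine_def)

lemma qconvex_hull: "qconvex (qconvex hull S)"
  by (rule hull_in) (simp add: qconvex_def)

lemma qaffine_hull: "qaffine (qaffine hull S)"
  by (rule hull_in) (simp add: qaffine_def)

lemma rat_convex_bound:
  fixes a b c u v :: rat
  assumes "c \<le> a" "c \<le> b" "0 \<le> u" "0 \<le> v" "u + v = 1"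
  shows "c \<le> u * a + v * b"
proof -
  have "c = u * c + v * c" using assms(5) by (simp flip: distrib_right)
  also have "\<dots> \<le> u * a + v * b" by (intro add_mono mult_left_mono assms)
  finally show ?thesis .
qed

lemma qconvex_halfspace: "qconvex {x. c \<le> pairing x y}"
  by (auto simp: qconvex_def pairing_linear intro!: rat_convex_bound)

lemma qconvex_dual_set: "qconvex (dual_set P)"
  by (auto simp: qconvex_def dual_set_def pairing_linear intro!: rat_convex_bound)

lemma qconvex_level_set: "qconvex P \<Longrightarrow> qconvex {x \<in> P. pairing x y = c}"
  by (auto simp: qconvex_def pairing_linear simp flip: distrib_right)

lemma qaffine_level_set: "qaffine {x. pairing v x = c}"
  by (auto simp: qaffine_def pairing_linear simp flip: distrib_right)

lemma dual_set_hull: "dual_set (qconvex hull V) = dual_set V"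
proof
  show "dual_set (qconvex hull V) \<subseteq> dual_set V"
    by (auto simp: dual_set_def hull_inc)
  show "dual_set V \<subseteq> dual_set (qconvex hull V)"
  proof
    fix y assume "y \<in> dual_set V"
    then have "qconvex hull V \<subseteq> {x. - 1 \<le> pairing x y}"
      by (intro hull_minimal qconvex_halfspace) (auto simp: dual_set_def)
    then show "y \<in> dual_set (qconvex hull V)" by (auto simp: dual_set_def)
  qed
qed

text \<open>
  An affine set through \<open>y0\<close> is a translate of a subspace. Closure of the translate under scaling is
  an affine combination with \<open>y0\<close>; closure under sums is obtained by scaling a midpoint by 2.
\<close>

lemma add_span_differences_in_qaffine_hull:
  assumes y0: "y0 \<in> S" and z: "z \<in> qvs.span {x - y | x y. x \<in> S \<and> y \<in> S}"
  shows "y0 + z \<in> qaffine hull S"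
proof -
  let ?A = "qaffine hull S"
  have aff: "qscale u x + qscale v y \<in> ?A" if "x \<in> ?A" "y \<in> ?A" "u + v = 1" for x y u v
    using qaffineD[OF qaffine_hull that] .
  have y0A: "y0 \<in> ?A" using y0 by (rule hull_inc)
  have scale: "y0 + qscale c x \<in> ?A" if "y0 + x \<in> ?A" for c x
    using aff[OF that y0A, of c "1 - c"]
    by (simp add: qvs.scale_right_distrib qvs.scale_left_diff_distrib algebra_simps)
  have sub: "qvs.subspace {z. y0 + z \<in> ?A}"
  proof (rule qvs.subspaceI; clarsimp simp: y0A scale)
    fix x y assume "y0 + x \<in> ?A" "y0 + y \<in> ?A"
    then have mid: "qscale (1/2) (y0 + x) + qscale (1/2) (y0 + y) \<in> ?A"
      by (rule aff) simp
    have half: "qscale (1/2) y0 + qscale (1/2) y0 = y0"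
      by (simp flip: qvs.scale_left_distrib)
    have "qscale (1/2) (y0 + x) + qscale (1/2) (y0 + y) =
        (qscale (1/2) y0 + qscale (1/2) y0) + qscale (1/2) (x + y)"
      by (simp add: qvs.scale_right_distrib ac_simps)
    with mid half have "y0 + qscale (1/2) (x + y) \<in> ?A" by simp
    from scale[OF this, of 2] show "y0 + (x + y) \<in> ?A" by simp
  qed
  have "x - y \<in> {z. y0 + z \<in> ?A}" if "x \<in> S" "y \<in> S" for x y
  proof -
    have "x - y0 \<in> {z. y0 + z \<in> ?A}" "y - y0 \<in> {z. y0 + z \<in> ?A}"
      using that by (simp_all add: hull_inc)
    from qvs.subspace_diff[OF sub this] show ?thesis by simp
  qed
  then have "qvs.span {x - y | x y. x \<in> S \<and> y \<in> S} \<subseteq> {z. y0 + z \<in> ?A}"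
    by (intro qvs.span_minimal sub) auto
  with z show ?thesis by auto
qed

section \<open>Neighbourhoods of the origin\<close>

text \<open>
  An interior origin can be moved a little along every line. The property passes from the
  generating strips to finite intersections and arbitrary unions, so it holds for all open sets.
\<close>

lemma interior_absorbing:
  assumes "0 \<in> qtopology interior_of S"
  obtains \<epsilon> where "\<epsilon> > 0" "\<And>t. \<bar>t\<bar> < \<epsilon> \<Longrightarrow> qscale t x \<in> S"
proof -
  obtain U where U: "openin qtopology U" "0 \<in> U" "U \<subseteq> S"
    using assms by (auto simp: interior_of_def)
  have "generate_topology_on {{x. a < pairing x y \<and> pairing x y < b} | a b y. True} U"
    using U(1) unfolding qtopology_def openin_topology_generated_by_iff .
  then have "0 \<in> U \<longrightarrow> (\<exists>\<epsilon>>0. \<forall>t. \<bar>t\<bar> < \<epsilon> \<longrightarrow> qscale t x \<in> U)"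
  proof induction
    case (Int U1 U2)
    show ?case
    proof
      assume "0 \<in> U1 \<inter> U2"
      with Int obtain d e where "d > 0" "e > 0"
        "\<forall>t. \<bar>t\<bar> < d \<longrightarrow> qscale t x \<in> U1" "\<forall>t. \<bar>t\<bar> < e \<longrightarrow> qscale t x \<in> U2" by auto
      then show "\<exists>\<epsilon>>0. \<forall>t. \<bar>t\<bar> < \<epsilon> \<longrightarrow> qscale t x \<in> U1 \<inter> U2"
        by (intro exI[of _ "min d e"]) auto
    qed
  next
    case (UN K)
    then show ?case by (meson UnionE UnionI)
  next
    case (Basis s)
    then obtain a b y where s: "s = {x. a < pairing x y \<and> pairing x y < b}" by auto
    show ?case
    proof
      assume "0 \<in> s"
      then have ab: "a < 0" "0 < b" by (auto simp: s pairing_linear)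
      \<comment> \<open>the summand 1 avoids a case distinction when the line is parallel to the strip\<close>
      define c where "c = 1 + \<bar>pairing x y\<bar>"
      have c: "c > 0" by (simp add: c_def add_pos_nonneg)
      show "\<exists>\<epsilon>>0. \<forall>t. \<bar>t\<bar> < \<epsilon> \<longrightarrow> qscale t x \<in> s"
      proof (intro exI[of _ "min (- a) b / c"] conjI allI impI)
        show "0 < min (- a) b / c" using ab c by simp
        fix t assume "\<bar>t\<bar> < min (- a) b / c"
        then have t: "\<bar>t\<bar> * c < min (- a) b" using c by (simp add: pos_less_divide_eq)
        have "\<bar>t * pairing x y\<bar> \<le> \<bar>t\<bar> * c"
          unfolding abs_mult by (rule mult_left_mono) (auto simp: c_def)
        then show "qscale t x \<in> s" using t by (auto simp: s pairing_linear)
      qed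
    qed
  qed auto
  with U that show ?thesis by blast
qed

lemma span_differences_UNIV_if_interior:
  assumes "0 \<in> qtopology interior_of S"
  shows "qvs.span {x - y | x y. x \<in> S \<and> y \<in> S} = UNIV"
proof -
  have "z \<in> qvs.span {x - y | x y. x \<in> S \<and> y \<in> S}" for z
  proof -
    obtain e where e: "e > 0" "\<And>t. \<bar>t\<bar> < e \<Longrightarrow> qscale t z \<in> S"
      using interior_absorbing[OF assms] by blast
    define t where "t = e / 2"
    have t: "t \<noteq> 0" "\<bar>t\<bar> < e" "\<bar>0\<bar> < e" using e(1) by (auto simp: t_def)
    have "qscale t z - qscale 0 z \<in> qvs.span {x - y | x y. x \<in> S \<and> y \<in> S}"
      using e(2)[OF t(2)] e(2)[OF t(3)] by (intro qvs.span_base) blast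
    from qvs.span_scale[OF this, of "1 / t"] show ?thesis using t by simp
  qed
  then show ?thesis by auto
qed

text \<open>
  The topology and the integral distance on the dual side are expressed by elements of the bidual
  lattice. The canonical map into it is all that is needed to relate them to the original pairing.
\<close>

lift_definition bidual :: "'m::ab_group_add \<Rightarrow> 'm zdual zdual" is "\<lambda>m f. zdual_apply f m"
  by (simp add: Modules.additive_def zdual_apply_plus)

lemma pairing_rfrac_bidual: "b \<noteq> 0 \<Longrightarrow> pairing y (rfrac (bidual m) b) = pairing (rfrac m b) y"
  by (cases y) (simp add: pairing_rfrac bidual.rep_eq mult.commute)

lemma openin_strip: "openin qtopology {y. a < pairing v y \<and> pairing v y < b}"
proof -
  obtain m c where v: "v = rfrac m c" "c \<noteq> 0" by (cases v)
  then have "{y. a < pairing v y \<and> pairing v y < b} =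
      {y. a < pairing y (rfrac (bidual m) c) \<and> pairing y (rfrac (bidual m) c) < b}"
    by (simp add: pairing_rfrac_bidual)
  then show ?thesis
    unfolding qtopology_def by (auto intro!: topology_generated_by_Basis)
qed

lemma zero_interior_dual_set:
  assumes "finite V"
  shows "0 \<in> qtopology interior_of (dual_set V)"
proof -
  let ?U = "topspace qtopology \<inter> (\<Inter>v\<in>V. {y. - 1 < pairing v y \<and> pairing v y < 1})"
  have "openin qtopology ?U"
    using assms by (intro openin_Int_Inter) (auto intro: openin_strip)
  moreover have "0 \<in> ?U" by (simp add: topspace_qtopology pairing_linear)
  moreover have "?U \<subseteq> dual_set V" by (auto simp: dual_set_def less_imp_le)
  ultimately show ?thesis unfolding interior_of_def by blast
qed

section \<open>Basic points of the dual of a finite set\<close>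

text \<open>
  Identities in the dual space can be checked after pairing, where they become identities of
  rational numbers.
\<close>

lemma eq_if_pairing_right_eq:
  assumes "\<And>x. pairing x y = pairing x y'"
  shows "y = y'"
  using pairing_eq_0_imp_right_0[of "y - y'"] assms by (simp add: pairing_linear)

definition tight :: "'m::ab_group_add rtensor set \<Rightarrow> 'm zdual rtensor \<Rightarrow> 'm rtensor set" where
  "tight V y = {v \<in> V. pairing v y = - 1}"

text \<open>
  In the language of linear programming these are the basic feasible solutions of the system of
  inequalities given by \<open>V\<close>.
\<close>

definition basic :: "'m::ab_group_add rtensor set \<Rightarrow> 'm zdual rtensor \<Rightarrow> bool" where
  "basic V y \<longleftrightarrow> y \<in> dual_set V \<and> (\<forall>z. (\<forall>v\<in>tight V y. pairing v z = 0) \<longrightarrow> z = 0)"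

text \<open>
  Ratio test of the simplex method: the constraints that decrease along \<open>z\<close> are not tight at \<open>y\<close>, and
  the first one of them to become tight determines the step length.
\<close>

lemma push_to_new_tight_constraint:
  assumes fin: "finite V" and y: "y \<in> dual_set V"
    and z: "\<And>v. v \<in> tight V y \<Longrightarrow> pairing v z = 0"
    and neg: "\<exists>v\<in>V. pairing v z < 0"
  obtains t where "t > 0" "y + qscale t z \<in> dual_set V" "tight V y \<subset> tight V (y + qscale t z)"
proof -
  define W where "W = {v \<in> V. pairing v z < 0}"
  define q where "q v = (1 + pairing v y) / (- pairing v z)" for v
  define t where "t = Min (q ` W)"
  have W: "finite W" "W \<noteq> {}" using fin neg by (auto simp: W_def)
  have "t \<in> q ` W" unfolding t_def using W by (intro Min_in) auto
  then obtain w where w: "w \<in> W" "t = q w" by auto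
  have tle: "t \<le> q v" if "v \<in> W" for v
    unfolding t_def using W that by (intro Min_le) auto
  have ge: "- 1 \<le> pairing v y" if "v \<in> V" for v
    using y that by (auto simp: dual_set_def)
  have wV: "w \<in> V" "pairing w z < 0" using w by (auto simp: W_def)
  have "w \<notin> tight V y" using z wV by fastforce
  then have "- 1 < pairing w y" using ge[OF wV(1)] wV by (auto simp: tight_def)
  then have t0: "t > 0" using wV by (simp add: w(2) q_def divide_pos_neg)
  have 1: "y + qscale t z \<in> dual_set V"
    unfolding dual_set_def
  proof clarify
    fix v assume v: "v \<in> V"
    show "- 1 \<le> pairing v (y + qscale t z)"
    proof (cases "pairing v z < 0")
      case True
      then have "t \<le> q v" using v tle by (auto simp: W_def)
      then have "t * (- pairing v z) \<le> 1 + pairing v y"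
        using True by (subst (asm) q_def, subst (asm) pos_le_divide_eq) auto
      then show ?thesis by (simp add: pairing_linear)
    next
      case False
      then have "0 \<le> t * pairing v z" using t0 by simp
      then show ?thesis using ge[OF v] by (simp add: pairing_linear)
    qed
  qed
  have "w \<in> tight V (y + qscale t z)"
    using wV by (simp add: tight_def pairing_linear w(2) q_def)
  moreover have "tight V y \<subseteq> tight V (y + qscale t z)"
    using z by (auto simp: tight_def pairing_linear)
  ultimately have "tight V y \<subset> tight V (y + qscale t z)"
    using \<open>w \<notin> tight V y\<close> by blast
  with t0 1 that show ?thesis by blast
qed

text \<open>
  Pushing along \<open>z\<close> and along \<open>-z\<close> puts \<open>y\<close> between two points with more tight constraints.
\<close>

lemma nonbasic_in_open_segment:
  assumes fin: "finite V" and y: "y \<in> dual_set V" and nb: "\<not> basic V y"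
    and neg: "\<And>z. z \<noteq> 0 \<Longrightarrow> \<exists>v\<in>V. pairing v z < 0"
  obtains a b where "a \<in> dual_set V" "b \<in> dual_set V" "y \<in> qopen_segment a b"
    "tight V y \<subset> tight V a" "tight V y \<subset> tight V b"
proof -
  obtain z where z: "z \<noteq> 0" "\<And>v. v \<in> tight V y \<Longrightarrow> pairing v z = 0"
    using nb y by (auto simp: basic_def)
  obtain t where t: "t > 0" "y + qscale t z \<in> dual_set V" "tight V y \<subset> tight V (y + qscale t z)"
    using push_to_new_tight_constraint[OF fin y z(2) neg[OF z(1)]] by blast
  obtain s where s: "s > 0" "y + qscale s (- z) \<in> dual_set V"
      "tight V y \<subset> tight V (y + qscale s (- z))"
    using push_to_new_tight_constraint[OF fin y, of "- z"] neg[of "- z"] z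
    by (auto simp: pairing_linear)
  \<comment> \<open>the weight that makes the displacements \<open>t z\<close> and \<open>-s z\<close> cancel\<close>
  define u where "u = t / (s + t)"
  have u: "0 < u" "u < 1" using s t by (auto simp: u_def)
  have "y = qscale (1 - u) (y + qscale t z) + qscale u (y + qscale s (- z))"
  proof (rule eq_if_pairing_right_eq)
    fix x
    have "u * (s + t) = t" using s t by (simp add: u_def)
    then have "(1 - u) * t = u * s" by (simp add: algebra_simps)
    then have "(1 - u) * (t * pairing x z) = u * (s * pairing x z)"
      by (metis mult.assoc)
    then show "pairing x y = pairing x
        (qscale (1 - u) (y + qscale t z) + qscale u (y + qscale s (- z)))"
      by (simp add: pairing_linear algebra_simps)
  qed
  moreover have "y + qscale t z \<noteq> y + qscale s (- z)"
  proof
    assume "y + qscale t z = y + qscale s (- z)"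
    then have "qscale (t + s) z = 0"
      by (simp add: qvs.scale_left_distrib)
    then show False using z(1) s t by auto
  qed
  ultimately have "y \<in> qopen_segment (y + qscale t z) (y + qscale s (- z))"
    using u unfolding qopen_segment_def by blast
  with that s t show ?thesis by blast
qed

text \<open>
  The difference of two basic points with the same tight set is orthogonal to that set, hence zero.
\<close>

lemma finite_basic:
  assumes "finite V"
  shows "finite {y. basic V y}"
proof (rule inj_on_finite[of "tight V" _ "Pow V"])
  show "inj_on (tight V) {y. basic V y}"
  proof (rule inj_onI, clarsimp)
    fix y y' assume yy': "basic V y" "basic V y'" "tight V y = tight V y'"
    have "pairing v (y - y') = 0" if "v \<in> tight V y" for v
    proof -
      have "v \<in> tight V y'" using that yy'(3) by simp
      with that show ?thesis by (simp add: tight_def pairing_linear)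
    qed
    then have "y - y' = 0" using yy'(1) unfolding basic_def by blast
    then show "y = y'" by simp
  qed
qed (use assms in \<open>auto simp: tight_def\<close>)

text \<open>
  Induction on the number of constraints that are not tight: a point that is not basic lies between
  two points for which this number is smaller.
\<close>

lemma dual_set_eq_hull_basic:
  assumes fin: "finite V" and neg: "\<And>z. z \<noteq> 0 \<Longrightarrow> \<exists>v\<in>V. pairing v z < 0"
  shows "dual_set V = qconvex hull {y. basic V y}"
proof
  show "qconvex hull {y. basic V y} \<subseteq> dual_set V"
    by (intro hull_minimal qconvex_dual_set) (auto simp: basic_def)
  have "y \<in> qconvex hull {y. basic V y}" if "y \<in> dual_set V" for y
    using that
  proof (induction "card (V - tight V y)" arbitrary: y rule: less_induct)
    case less
    show ?case
    proof (cases "basic V y")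
      case False
      obtain a b where ab: "a \<in> dual_set V" "b \<in> dual_set V" "y \<in> qopen_segment a b"
        "tight V y \<subset> tight V a" "tight V y \<subset> tight V b"
        using nonbasic_in_open_segment[OF fin less.prems False neg] by blast
      have "tight V x \<subseteq> V" for x by (auto simp: tight_def)
      then have "V - tight V a \<subset> V - tight V y" "V - tight V b \<subset> V - tight V y"
        using ab(4,5) by blast+
      then have "card (V - tight V a) < card (V - tight V y)"
        "card (V - tight V b) < card (V - tight V y)"
        using fin by (simp_all add: psubset_card_mono)
      from less.hyps[OF this(1) ab(1)] less.hyps[OF this(2) ab(2)] show ?thesis
        using ab(3) by (auto simp: qopen_segment_def intro!: qconvexD[OF qconvex_hull])
    qed (simp add: hull_inc)
  qed
  then show "dual_set V \<subseteq> qconvex hull {y. basic V y}" by auto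
qed

lemma vertex_imp_basic:
  assumes fin: "finite V" and neg: "\<And>z. z \<noteq> 0 \<Longrightarrow> \<exists>v\<in>V. pairing v z < 0"
    and v: "y qvertex_of dual_set V"
  shows "basic V y"
proof (rule ccontr)
  assume nb: "\<not> basic V y"
  have y: "y \<in> dual_set V" using v by (auto simp: qvertex_of_def qface_of_def)
  obtain a b where ab: "a \<in> dual_set V" "b \<in> dual_set V" "y \<in> qopen_segment a b"
    "tight V y \<subset> tight V a" "tight V y \<subset> tight V b"
    using nonbasic_in_open_segment[OF fin y nb neg] by blast
  then have "a = y" using v by (auto simp: qvertex_of_def qface_of_def)
  with ab show False by auto
qed

section \<open>Reflexivity of the dual polytope\<close>

lemma qscale_of_int_of_lattice: "qscale (of_int k) (of_lattice m) = of_lattice (zscale k m)"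
  using qscale_Fract[of 1 1 k m] by (simp add: of_lattice_conv_rfrac Fract_of_int_eq)

text \<open>
  Otherwise the hull lies in the half-space \<open>\<langle>x, z\<rangle> \<ge> 0\<close>, whose boundary contains the origin. This is
  how the interior origin bounds the dual set.
\<close>

lemma negative_on_generators:
  assumes abs: "0 \<in> qtopology interior_of (qconvex hull V)" and z: "z \<noteq> 0"
  shows "\<exists>v\<in>V. pairing v z < 0"
proof (rule ccontr)
  assume "\<not> ?thesis"
  then have "qconvex hull V \<subseteq> {x. 0 \<le> pairing x z}"
    by (intro hull_minimal qconvex_halfspace) (auto simp: not_less)
  then have nonneg: "0 \<le> pairing x z" if "x \<in> qconvex hull V" for x using that by auto
  have "pairing x z = 0" for x
  proof -
    obtain e where e: "e > 0" "\<And>t. \<bar>t\<bar> < e \<Longrightarrow> qscale t x \<in> qconvex hull V"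
      using interior_absorbing[OF abs] by blast
    have "0 \<le> (e / 2) * pairing x z" "0 \<le> (- e / 2) * pairing x z"
      using nonneg[OF e(2), of "e / 2"] nonneg[OF e(2), of "- e / 2"] e(1)
      by (simp_all add: pairing_linear)
    then show ?thesis using e(1) by (simp add: zero_le_mult_iff mult_le_0_iff)
  qed
  with z pairing_eq_0_imp_right_0 show False by blast
qed

lemma level_on_open_segment:
  assumes x: "x \<in> qopen_segment a b" "pairing x y = - 1"
    and ge: "- 1 \<le> pairing a y" "- 1 \<le> pairing b y"
  shows "pairing a y = - 1 \<and> pairing b y = - 1"
proof -
  obtain u where u: "0 < u" "u < 1" "x = qscale (1 - u) a + qscale u b"
    using x(1) by (auto simp: qopen_segment_def)
  have "(1 - u) * (pairing a y + 1) + u * (pairing b y + 1) = 0"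
    using x(2) u(3) by (simp add: pairing_linear algebra_simps)
  moreover have "0 \<le> (1 - u) * (pairing a y + 1)" "0 \<le> u * (pairing b y + 1)"
    using u ge by simp_all
  ultimately have "(1 - u) * (pairing a y + 1) = 0" "u * (pairing b y + 1) = 0"
    by linarith+
  then show ?thesis using u by auto
qed

lemma level_set_qface_of:
  assumes P: "qconvex P" and y: "y \<in> dual_set P"
  shows "{x \<in> P. pairing x y = - 1} qface_of P"
  unfolding qface_of_def
proof (intro conjI ballI impI)
  show "qconvex {x \<in> P. pairing x y = - 1}" using P by (rule qconvex_level_set)
  fix a b x
  assume a: "a \<in> P" and b: "b \<in> P" and x: "x \<in> {x \<in> P. pairing x y = - 1}"
    and seg: "x \<in> qopen_segment a b"
  have "pairing a y = - 1 \<and> pairing b y = - 1"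
    using a b x y by (intro level_on_open_segment[OF seg]) (auto simp: dual_set_def)
  with a b show "a \<in> {x \<in> P. pairing x y = - 1}" "b \<in> {x \<in> P. pairing x y = - 1}" by auto
qed auto

lemma span_differences_in_kernel:
  assumes "F \<subseteq> {x. pairing x y = c}"
  shows "qvs.span {a - b | a b. a \<in> F \<and> b \<in> F} \<subseteq> {x. pairing x y = 0}"
proof -
  have "qvs.span {a - b | a b. a \<in> F \<and> b \<in> F} \<subseteq> {x. \<forall>y\<in>{y}. pairing x y = 0}"
    using assms by (intro qvs.span_minimal subspace_annihilator_left) (auto simp: pairing_linear subset_iff)
  then show ?thesis by simp
qed

text \<open>
  The differences of points of \<open>F\<close> lie in the kernel of \<open>y\<close>, and one further point of \<open>F\<close>, which is not in
  that kernel, suffices to span the whole space.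
\<close>

lemma qaff_dim_spanning_level_set:
  assumes free: "free_abelian_of_rank TYPE('m::ab_group_add) n"
    and F: "F \<subseteq> {x :: 'm rtensor. pairing x y = - 1}" and span: "qvs.span F = UNIV" and "F \<noteq> {}"
  shows "qaff_dim F = int n - 1"
proof -
  obtain a0 where a0: "a0 \<in> F" using assms(4) by auto
  let ?D = "{a - b | a b. a \<in> F \<and> b \<in> F}"
  obtain E :: "'m rtensor set" where E: "finite_dimensional_vector_space qscale E" "card E = n"
    using finite_basis_of_rtensor[OF free] by blast
  interpret fd: finite_dimensional_vector_space qscale E by (rule E(1))
  have "F \<subseteq> qvs.span (insert a0 ?D)"
  proof
    fix a assume "a \<in> F"
    then have "(a - a0) + a0 \<in> qvs.span (insert a0 ?D)"
      using a0 by (intro qvs.span_add qvs.span_base) auto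
    then show "a \<in> qvs.span (insert a0 ?D)" by simp
  qed
  then have "qvs.span F \<subseteq> qvs.span (insert a0 ?D)"
    by (intro qvs.span_minimal qvs.subspace_span)
  then have "qvs.span (insert a0 ?D) = UNIV" using span by auto
  then have "qvs.dim (insert a0 ?D) = n"
    using fd.dim_eq_full[of "insert a0 ?D"] E(2) by (simp add: fd.dimension_def)
  moreover have "a0 \<notin> qvs.span ?D"
    using span_differences_in_kernel[OF F] subsetD[OF F a0] by auto
  ultimately have "qvs.dim ?D + 1 = n" by (simp add: fd.dim_insert)
  then show ?thesis using \<open>F \<noteq> {}\<close> by (auto simp: qaff_dim_def)
qed

text \<open>
  At a basic point \<open>y\<close> the tight generators span, so \<open>\<langle>x, y\<rangle> = -1\<close> cuts out a facet, to which
  reflexivity applies. The normalised equation of its hyperplane is unique, so \<open>y\<close> is \<open>\<plusminus>l\<close> for the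
  lattice point \<open>l\<close> in the definition of the integral distance.
\<close>

lemma basic_imp_lattice:
  assumes free: "free_abelian_of_rank TYPE('m::ab_group_add) n"
    and refl: "reflexive_pair n (qconvex hull V :: 'm rtensor set)"
    and y: "basic V y"
  shows "y \<in> range of_lattice"
proof (cases "tight V y = {}")
  \<comment> \<open>a basic point without tight constraints exists only in rank 0, where there are no facets\<close>
  case True
  then have "y = 0" using y by (auto simp: basic_def)
  then show ?thesis using of_lattice_0 by (metis rangeI)
next
  case False
  define F where "F = {x \<in> qconvex hull V. pairing x y = - 1}"
  have TF: "tight V y \<subseteq> F" by (auto simp: tight_def F_def hull_inc)
  have "y \<in> dual_set (qconvex hull V)" using y by (simp add: basic_def dual_set_hull)
  then have face: "F qface_of (qconvex hull V)"
    unfolding F_def by (intro level_set_qface_of qconvex_hull)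
  have "qvs.span F = UNIV"
    using y TF unfolding basic_def by (intro span_eq_UNIV_if_annihilator_0[OF free]) blast
  then have "qaff_dim F = int n - 1"
    using False TF by (intro qaff_dim_spanning_level_set[OF free, of F y]) (auto simp: F_def)
  then have "has_integral_distance (qaffine hull F) 0 1"
    using refl face False TF unfolding reflexive_pair_def by blast
  then obtain l c where l: "qaffine hull F = {x. pairing x (of_lattice l) = of_int c}"
      and c: "1 = \<bar>c - zdual_apply l 0\<bar>"
    unfolding has_integral_distance_def by blast
  have "zdual_apply l 0 = 0" by (rule Modules.additive.zero[OF additive_zdual_apply])
  with c have "c * c = 1" by (auto simp: abs_if split: if_splits)
  then have cc: "(of_int c * of_int c :: rat) = 1" by (metis of_int_1 of_int_mult)
  have "pairing v (y + qscale (of_int c) (of_lattice l)) = 0" if "v \<in> tight V y" for v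
  proof -
    have "v \<in> qaffine hull F" using that TF by (auto intro: hull_inc)
    then have "pairing v (of_lattice l) = of_int c" using l by auto
    then show ?thesis using that cc by (simp add: pairing_linear tight_def)
  qed
  then have "y + qscale (of_int c) (of_lattice l) = 0" using y unfolding basic_def by blast
  then have "y = qscale (of_int (- c)) (of_lattice l)"
    by (simp add: eq_neg_iff_add_eq_0)
  then show ?thesis unfolding qscale_of_int_of_lattice by blast
qed

text \<open>
  If every constraint is slack somewhere on \<open>F\<close>, then averaging produces a point \<open>y\<close> of \<open>F\<close> at which all
  constraints are slack. Every point \<open>b\<close> of the dual set is then an end of a segment in the dual
  set with \<open>y\<close> in its interior, so \<open>F\<close> is everything.
\<close>

lemma face_common_tight:
  assumes fin: "finite V" and neq: "V \<noteq> {}" and face: "F qface_of dual_set V"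
    and ne: "F \<noteq> {}" and proper: "F \<noteq> dual_set V"
  shows "\<exists>v\<in>V. \<forall>y\<in>F. pairing v y = - 1"
proof (rule ccontr)
  assume "\<not> ?thesis"
  then have ex: "\<exists>y\<in>F. pairing v y \<noteq> - 1" if "v \<in> V" for v using that by auto
  have FP: "F \<subseteq> dual_set V" and cF: "qconvex F" using face by (auto simp: qface_of_def)
  have ge: "- 1 \<le> pairing v y" if "y \<in> F" "v \<in> V" for v y
    using that FP by (auto simp: dual_set_def)
  have "\<exists>y\<in>F. \<forall>v\<in>W. - 1 < pairing v y" if "finite W" "W \<subseteq> V" for W
    using that
  proof (induction W rule: finite_induct)
    case empty
    then show ?case using ne by auto
  next
    case (insert w W)
    then obtain y1 where y1: "y1 \<in> F" "\<forall>v\<in>W. - 1 < pairing v y1" by auto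
    obtain y2 where y2: "y2 \<in> F" "pairing w y2 \<noteq> - 1" using ex insert.prems by auto
    let ?y = "qscale (1/2) y1 + qscale (1/2) y2"
    have "?y \<in> F" using y1 y2 by (intro qconvexD[OF cF]) auto
    moreover have "- 1 < pairing v ?y" if v: "v \<in> insert w W" for v
    proof -
      have "v \<in> V" using v insert.prems by auto
      then have "- 1 \<le> pairing v y1" "- 1 \<le> pairing v y2" using ge y1 y2 by auto
      moreover have "- 1 < pairing v y1 \<or> - 1 < pairing v y2"
        using v y1 y2 calculation by auto
      ultimately show ?thesis by (auto simp: pairing_linear)
    qed
    ultimately show ?case by blast
  qed
  from this[OF fin] obtain y where y: "y \<in> F" "\<forall>v\<in>V. - 1 < pairing v y" by auto
  have "b \<in> F" if b: "b \<in> dual_set V" for b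
  proof (cases "b = y")
    case False
    let ?z = "y - b"
    \<comment> \<open>small enough that \<open>y\<close> can be moved away from \<open>b\<close> by \<open>e ?z\<close> without violating a constraint\<close>
    define e where "e = Min ((\<lambda>v. (1 + pairing v y) / (1 + \<bar>pairing v ?z\<bar>)) ` V)"
    have e0: "e > 0"
      unfolding e_def using fin neq y(2)
      by (subst Min_gr_iff) (auto intro!: divide_pos_pos simp: add_pos_nonneg)
    have "y + qscale e ?z \<in> dual_set V"
      unfolding dual_set_def
    proof clarify
      fix v assume v: "v \<in> V"
      have "e \<le> (1 + pairing v y) / (1 + \<bar>pairing v ?z\<bar>)"
        unfolding e_def using fin v by (intro Min_le) auto
      then have "e * (1 + \<bar>pairing v ?z\<bar>) \<le> 1 + pairing v y"
        by (subst (asm) pos_le_divide_eq) (auto simp: add_pos_nonneg)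
      moreover have "- (e * \<bar>pairing v ?z\<bar>) \<le> e * pairing v ?z"
        using e0 by (simp add: abs_if mult_le_0_iff zero_le_mult_iff)
      ultimately have "- 1 \<le> pairing v y + e * pairing v ?z"
        using e0 by (simp add: distrib_left)
      then show "- 1 \<le> pairing v (y + qscale e ?z)"
        by (simp only: pairing_add_right pairing_scale_right)
    qed
    moreover have "y \<in> qopen_segment (y + qscale e ?z) b"
      unfolding qopen_segment_def
    proof (intro CollectI exI[of _ "e / (1 + e)"] conjI)
      show "0 < e / (1 + e)" "e / (1 + e) < 1" using e0 by auto
      define s where "s = 1 / (1 + e)"
      have s: "s * (1 + e) = 1" "e / (1 + e) = s * e" "1 - s * e = s"
        using e0 by (simp_all add: s_def field_simps)
      show "y = qscale (1 - e / (1 + e)) (y + qscale e ?z) + qscale (e / (1 + e)) b"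
        unfolding s(2,3)
      proof (rule eq_if_pairing_right_eq)
        fix x
        have "pairing x (qscale s (y + qscale e ?z) + qscale (s * e) b) = (s * (1 + e)) * pairing x y"
          by (simp add: pairing_linear algebra_simps)
        then show "pairing x y = pairing x (qscale s (y + qscale e ?z) + qscale (s * e) b)"
          by (simp add: s(1))
      qed
      show "y + qscale e ?z \<noteq> b"
      proof
        assume "y + qscale e ?z = b"
        then have "qscale (1 + e) ?z = 0" by (simp add: qvs.scale_left_distrib algebra_simps)
        then show False using False e0 by auto
      qed
    qed
    ultimately show ?thesis using face b y(1) unfolding qface_of_def by blast
  qed (use y in simp)
  with FP proper show False by blast
qed

lemma qaffine_hull_of_codim_1:
  assumes free: "free_abelian_of_rank TYPE('m::ab_group_add) n"
    and F: "F \<subseteq> {y :: 'm zdual rtensor. pairing v y = - 1}" and "F \<noteq> {}"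
    and dim: "qaff_dim F = int n - 1"
  shows "qaffine hull F = {y. pairing v y = - 1}"
proof
  show "qaffine hull F \<subseteq> {y. pairing v y = - 1}"
    using F by (intro hull_minimal qaffine_level_set)
  obtain y0 where y0: "y0 \<in> F" using assms(3) by auto
  let ?D = "{a - b | a b. a \<in> F \<and> b \<in> F}"
  obtain D :: "'m zdual rtensor set" where D: "finite_dimensional_vector_space qscale D" "card D = n"
    using finite_basis_of_dual_rtensor[OF free] by blast
  interpret fd: finite_dimensional_vector_space qscale D by (rule D(1))
  have dimD: "qvs.dim ?D + 1 = n" using dim \<open>F \<noteq> {}\<close> by (simp add: qaff_dim_def)
  have "qvs.span ?D \<subseteq> {y. \<forall>v\<in>{v}. pairing v y = 0}"
    using F by (intro qvs.span_minimal subspace_annihilator_right) (auto simp: pairing_linear subset_iff)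
  then have sub: "qvs.span ?D \<subseteq> {y. pairing v y = 0}" by simp
  have "z \<in> qvs.span ?D" if z: "pairing v z = 0" for z
  proof (rule ccontr)
    assume "z \<notin> qvs.span ?D"
    then have "qvs.dim (insert z ?D) = n" using dimD by (simp add: fd.dim_insert)
    then have "qvs.span (insert z ?D) = UNIV"
      using fd.dim_eq_full[of "insert z ?D"] D(2) by (simp add: fd.dimension_def)
    moreover have "qvs.span (insert z ?D) \<subseteq> {y. \<forall>v\<in>{v}. pairing v y = 0}"
      using sub z by (intro qvs.span_minimal subspace_annihilator_right) (auto intro: qvs.span_base)
    ultimately have "pairing v y0 = 0" by auto
    then show False using F y0 by auto
  qed
  then have "y0 + (y - y0) \<in> qaffine hull F" if "pairing v y = - 1" for y
    using that y0 F by (intro add_span_differences_in_qaffine_hull) (auto simp: pairing_linear)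
  then show "{y. pairing v y = - 1} \<subseteq> qaffine hull F" by auto
qed

text \<open>
  If \<open>v\<close> is inside a segment with ends \<open>a\<close> and \<open>b\<close> in \<open>P\<close>, then \<open>\<langle>a, y\<rangle> = \<langle>b, y\<rangle> = -1\<close> on \<open>F\<close>, hence on the
  whole hyperplane \<open>\<langle>v, y\<rangle> = -1\<close>. As this hyperplane spans the dual space, \<open>a = b = v\<close>.
\<close>

lemma tight_on_facet_is_vertex:
  assumes free: "free_abelian_of_rank TYPE('m::ab_group_add) n"
    and v: "v \<in> P" and F: "F \<subseteq> dual_set (P :: 'm rtensor set)" and "F \<noteq> {}"
    and hull: "qaffine hull F = {y. pairing v y = - 1}"
  shows "v qvertex_of P"
proof -
  have tight: "pairing v y = - 1" if "y \<in> F" for y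
    using that hull by (auto dest: hull_inc[of _ _ qaffine])
  have unique: "a = v" if a: "\<And>y. y \<in> F \<Longrightarrow> pairing a y = - 1" for a
  proof -
    have "qaffine hull F \<subseteq> {y. pairing a y = - 1}"
      using a by (intro hull_minimal qaffine_level_set) auto
    then have H: "pairing a y = - 1" if "pairing v y = - 1" for y using that hull by auto
    obtain y0 where y0: "y0 \<in> F" using \<open>F \<noteq> {}\<close> by auto
    have "pairing (a - v) y = 0" for y
    proof (cases "pairing v y = 0")
      case True
      then have "pairing a (y0 + y) = - 1" using tight[OF y0] by (intro H) (simp add: pairing_linear)
      then show ?thesis using True a[OF y0] by (simp add: pairing_linear)
    next
      case False
      then have "pairing a (qscale (- 1 / pairing v y) y) = - 1"
        by (intro H) (simp add: pairing_linear)
      then show ?thesis using False by (simp add: pairing_linear field_simps)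
    qed
    then have "a - v = 0" by (rule pairing_eq_0_imp_left_0[OF free])
    then show ?thesis by simp
  qed
  have "a = v \<and> b = v" if ab: "a \<in> P" "b \<in> P" and v_ab: "v \<in> qopen_segment a b" for a b
  proof -
    have "pairing a y = - 1 \<and> pairing b y = - 1" if y: "y \<in> F" for y
      using ab y F by (intro level_on_open_segment[OF v_ab tight]) (auto simp: dual_set_def)
    then show ?thesis using unique by blast
  qed
  moreover have "qconvex {v}" by (simp add: qconvex_def flip: qvs.scale_left_distrib)
  ultimately show ?thesis using v unfolding qvertex_of_def qface_of_def by blast
qed

text \<open>
  A single lattice point \<open>w\<close> on the hyperplane is enough. A divisor of \<open>m\<close> divides \<open>\<langle>m, w\<rangle> = -1\<close>, so \<open>m\<close> is
  primitive; and any other point of the hyperplane differs from \<open>w\<close> by some \<open>f / a\<close> with a lattice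
  point \<open>f\<close> orthogonal to \<open>m\<close>, so it lies on the line through the lattice points \<open>w\<close> and \<open>w + f\<close>.
\<close>

lemma lattice_hyperplane_integral_distance:
  assumes w: "zdual_apply w m = - 1"
  shows "has_integral_distance {y. pairing (of_lattice m) y = - 1} (0 :: 'm::ab_group_add zdual) 1"
    (is "has_integral_distance ?H 0 1")
  unfolding has_integral_distance_def
proof (intro conjI exI[of _ "bidual m"] exI[of _ "- 1"])
  let ?A = "qaffine hull (?H \<inter> range of_lattice)"
  have wH: "of_lattice w \<in> ?H" using w by (simp add: pairing_of_lattice)
  show "?H = ?A"
  proof
    show "?A \<subseteq> ?H" by (intro hull_minimal qaffine_level_set) auto
    show "?H \<subseteq> ?A"
    proof
      fix y assume y: "y \<in> ?H"
      obtain f a where f: "y - of_lattice w = rfrac f a" "a \<noteq> 0" by (cases "y - of_lattice w")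
      have "pairing (of_lattice m) (rfrac f a) = 0"
        unfolding f(1)[symmetric] using y wH by (simp add: pairing_linear)
      then have "zdual_apply f m = 0"
        using f(2) by (simp add: of_lattice_conv_rfrac pairing_rfrac)
      then have "of_lattice (w + f) \<in> ?H"
        using w by (simp add: pairing_of_lattice zdual_apply_plus)
      then have wf: "of_lattice (w + f) \<in> ?A" by (auto intro: hull_inc)
      have w': "of_lattice w \<in> ?A" using wH by (auto intro: hull_inc)
      have "y = of_lattice w + qscale (1 / of_int a) (of_lattice f)"
        using f by (simp add: rfrac_conv_qscale algebra_simps)
      also have "\<dots> = qscale (1 - 1 / of_int a) (of_lattice w) + qscale (1 / of_int a) (of_lattice (w + f))"
        by (simp add: Modules.additive.add[OF of_lattice_additive] qvs.scale_right_distrib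
            qvs.scale_left_diff_distrib)
      also have "\<dots> \<in> ?A" using w' wf by (intro qaffineD[OF qaffine_hull]) auto
      finally show "y \<in> ?A" .
    qed
  qed
  show "primitive (bidual m)"
    unfolding primitive_def
  proof (intro conjI allI impI notI)
    assume "bidual m = 0"
    then have "zdual_apply (bidual m) w = 0" by (simp add: zero_zdual.rep_eq)
    then show False using w by (simp add: bidual.rep_eq)
  next
    fix k l' assume "bidual m = zscale k l'"
    then have "zdual_apply (bidual m) w = k * zdual_apply l' w" by (simp add: zdual_apply_zscale_left)
    then have "k dvd 1" using w by (metis bidual.rep_eq dvd_triv_left dvd_minus_iff)
    then show "\<bar>k\<bar> = 1" by simp
  qed
  show "?H = {x. pairing x (of_lattice (bidual m)) = of_int (- 1)}"
    by (simp add: of_lattice_conv_rfrac pairing_rfrac_bidual)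
  show "1 = \<bar>- 1 - zdual_apply (bidual m) 0\<bar>"
    by (simp add: bidual.rep_eq zero_zdual.rep_eq)
qed

lemma level_set_meets_generators:
  assumes y: "y \<in> qconvex hull W" and v: "pairing v y = - 1"
    and ge: "\<And>w. w \<in> W \<Longrightarrow> - 1 \<le> pairing v w"
  shows "\<exists>w\<in>W. pairing v w = - 1"
proof (rule ccontr)
  assume "\<not> ?thesis"
  with ge have "W \<subseteq> {w. - 1 < pairing v w}" by fastforce
  moreover have "qconvex {w. - 1 < pairing v w}"
    unfolding qconvex_def
  proof (clarsimp simp: pairing_linear)
    fix a b and s t :: rat
    assume *: "- 1 < pairing v a" "- 1 < pairing v b" "0 \<le> s" "0 \<le> t" "s + t = 1"
    have "s * (- pairing v a) + t * (- pairing v b) < 1"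
      using * by (intro convex_bound_lt) auto
    then show "- 1 < s * pairing v a + t * pairing v b" by simp
  qed
  ultimately have "qconvex hull W \<subseteq> {w. - 1 < pairing v w}" by (rule hull_minimal)
  with y v show False by auto
qed

theorem theorem4p1p6:
  fixes \<Delta> :: "'m::ab_group_add rtensor set" and n :: nat
  assumes "free_abelian_of_rank TYPE('m) n"
    and "reflexive_pair n \<Delta>"
  shows "reflexive_pair n (dual_set \<Delta>)"
proof -
  note free = assms(1) and refl = assms(2)
  obtain V where fin: "finite V" and \<Delta>: "\<Delta> = qconvex hull V"
    using refl by (auto simp: reflexive_pair_def qpolytope_def)
  have int: "0 \<in> qtopology interior_of (qconvex hull V)"
    and vert: "\<And>v. v qvertex_of \<Delta> \<Longrightarrow> v \<in> range of_lattice"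
    using refl \<Delta> by (auto simp: reflexive_pair_def)
  have neg: "\<exists>v\<in>V. pairing v z < 0" if "z \<noteq> 0" for z
    using negative_on_generators[OF int that] .
  define W where "W = {y. basic V y}"
  have dual: "dual_set \<Delta> = dual_set V" by (simp add: \<Delta> dual_set_hull)
  have hullW: "dual_set V = qconvex hull W"
    unfolding W_def by (rule dual_set_eq_hull_basic[OF fin neg])
  have W: "y \<in> range of_lattice" if "y \<in> W" for y
    using that basic_imp_lattice[OF free refl[unfolded \<Delta>]] by (simp add: W_def)
  have int': "0 \<in> qtopology interior_of (dual_set V)" by (rule zero_interior_dual_set[OF fin])
  have zero: "0 \<in> dual_set V" by (simp add: dual_set_def pairing_linear)
  have "V \<noteq> {}"
  proof
    assume "V = {}"
    then have "\<Delta> = {}" using \<Delta> hull_same[of qconvex "{}"] by (simp add: qconvex_def)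
    then show False using int \<Delta> interior_of_subset by fast
  qed
  show ?thesis
    unfolding reflexive_pair_def dual
  proof (intro conjI allI impI)
    show "qpolytope (dual_set V)"
      unfolding qpolytope_def using hullW finite_basic[OF fin] W_def by blast
    obtain D :: "'m zdual rtensor set" where D: "finite_dimensional_vector_space qscale D" "card D = n"
      using finite_basis_of_dual_rtensor[OF free] by blast
    interpret fd: finite_dimensional_vector_space qscale D by (rule D(1))
    let ?D = "{x - y | x y. x \<in> dual_set V \<and> y \<in> dual_set V}"
    have "qvs.dim ?D = n"
      using fd.dim_eq_full[of ?D] span_differences_UNIV_if_interior[OF int'] D(2)
      by (simp add: fd.dimension_def)
    then show dimn: "qaff_dim (dual_set V) = int n" using zero by (auto simp: qaff_dim_def)
    show "0 \<in> qtopology interior_of (dual_set V)" by (rule int')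
    show "y \<in> range of_lattice" if "y qvertex_of dual_set V" for y
      using W vertex_imp_basic[OF fin neg that] by (simp add: W_def)
    fix F assume "F qface_of dual_set V \<and> F \<noteq> {} \<and> qaff_dim F = int n - 1"
    then have F: "F qface_of dual_set V" "F \<noteq> {}" "qaff_dim F = int n - 1" by auto
    have "F \<noteq> dual_set V" using F(3) dimn by auto
    then obtain v where v: "v \<in> V" "\<forall>y\<in>F. pairing v y = - 1"
      using face_common_tight[OF fin \<open>V \<noteq> {}\<close> F(1,2)] by blast
    have H: "qaffine hull F = {y. pairing v y = - 1}"
      using v F by (intro qaffine_hull_of_codim_1[OF free]) auto
    have FP: "F \<subseteq> dual_set V" using F(1) by (simp add: qface_of_def)
    have "v qvertex_of \<Delta>"
      using FP v(1) by (intro tight_on_facet_is_vertex[OF free _ _ F(2) H])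
        (auto simp: dual_set_hull \<Delta> hull_inc)
    then obtain m where m: "v = of_lattice m" using vert by blast
    obtain y where y: "y \<in> F" using F(2) by auto
    \<comment> \<open>the facet contains a basic point, which supplies the lattice point of the hyperplane\<close>
    have "\<exists>w\<in>W. pairing v w = - 1"
    proof (rule level_set_meets_generators)
      show "y \<in> qconvex hull W" using y FP hullW by auto
      show "pairing v y = - 1" using y v by simp
      show "- 1 \<le> pairing v w" if "w \<in> W" for w
        using that v(1) by (auto simp: W_def basic_def dual_set_def)
    qed
    then obtain w where w: "w \<in> W" "pairing v w = - 1" by auto
    then obtain f where f: "w = of_lattice f" using W by blast
    have "(of_int (zdual_apply f m) :: rat) = of_int (- 1)"
      using w(2) by (simp add: m f pairing_of_lattice)
    then have "zdual_apply f m = - 1" by (simp only: of_int_eq_iff)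
    then show "has_integral_distance (qaffine hull F) 0 1"
      unfolding H m by (rule lattice_hyperplane_integral_distance)
  qed
qed

end
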